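(* Let $u\in\mu_{p-1}\subset\mathbb{Z}_p^\times$, $f_u(X)=X^p+upX$, and let $\{\omega_{u,n}\}_{n\ge0}$ be a coherent set of roots associated to $f_u$. Then for every $n\in\mathbb{N}$, the $\mathcal{R}_{\mathbb{Q}_p(\omega_{u,n})}$-differential module defined by $$\partial_X-\sum_{i=0}^{n-1}\omega_{u,n-i}X^{p^i}$$ has Frobenius structure, i.e. there is an absolute Frobenius $\phi$ on $\mathcal{R}_{\mathbb{Q}_p(\omega_{u,n})}$ such that this module $M$ is isomorphic to $\phi^*(M)$.
   Context: $p$ is an odd prime; $\mu_{p-1}$ is the group of $(p-1)$th roots of unity. A coherent set of roots for $f_u$ is a sequence $\omega_{u,i}\in\bar{\mathbb{Q}}_p$ with $\omega_{u,0}=0\ne\omega_{u,1}$ and $f_u(\omega_{u,i})=\omega_{u,i-1}$. For a finite extension $L/\mathbb{Q}_p$, $\mathcal{R}_L$ is the Robba ring of series $\sum_{n\in\mathbb{Z}}a_nX^n$, $a_n\in L$, with $\lim_{n\to+\infty}|a_n|_p\alpha^n=0$ for some $0<\alpha<1$ and $\lim_{n\to-\infty}|a_n|_p\rho^n=0$ for all $0<\rho<1$, with derivation $\partial_X=X\frac{d}{dX}$. An $\mathcal{R}_L$-differential module is an $\mathcal{R}_L$-module $M$ with additive $D:M\to M$ satisfying $D(am)=aD(m)+\partial_X(a)m$; isomorphisms are $\mathcal{R}_L$-linear bijections commuting with the operators. A free rank one differential module is defined by $\partial_X-g$ ($g\in\mathcal{R}_L$) if it has a basis $\varepsilon$ with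 $D(\varepsilon)=g\varepsilon$ (such modules are unique up to isomorphism). An absolute Frobenius on $\mathcal{R}_L$ is $\phi(\sum a_iX^i)=\sum\varphi(a_i)X^{pi}$, where $\varphi$ is a continuous $\mathbb{Q}_p$-automorphism of $L$ lifting the Frobenius of the residue field extension $k_L/\mathbb{F}_p$. The functor $\phi^*$ sends (the isomorphism class of) the rank one module defined by $\partial_X-g(X)$ to the module defined by $\partial_X-p\phi(g(X))$. A rank one differential module $M$ has Frobenius structure if $M\cong\phi^*(M)$. *)

theory Defs
  imports "HOL-Analysis.Analysis" "HOL-Algebra.Algebraic_Closure_Type" "HOL-Algebra.Generated_Fields"
    "HOL-Algebra.Module"
begin

section \<open>An algebraic closure of the p-adic numbers\<close>

definition Qp :: "('k::field_char_0 \<Rightarrow> real) \<Rightarrow> 'k set" where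
  "Qp v = {x. \<forall>e>0. \<exists>q\<in>\<rat>. v (x - q) < e}"

text \<open>
  The type \<open>'k\<close> with the function \<open>v\<close> is an algebraic closure of the field of
  p-adic numbers with the extension of the p-adic absolute value normalised by \<open>|p| = 1/p\<close>:
  the closure of the rationals is complete, i.e. it is the completion of the rationals at \<open>p\<close>,
  and \<open>'k\<close> is an algebraic closure of it. This determines the pair up to isometric isomorphism.
\<close>

locale padic_algebraic_closure =
  fixes p :: nat and v :: "'k::field_char_0 \<Rightarrow> real"
  assumes prime_p: "Factorial_Ring.prime p"
    and v_nonneg: "v x \<ge> 0"
    and v_eq_0_iff: "v x = 0 \<longleftrightarrow> x = 0"
    and v_mult: "v (x * y) = v x * v y"
    and v_add_le: "v (x + y) \<le> max (v x) (v y)"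
    and v_p: "v (of_nat p) = 1 / real p"
    and Qp_complete:
      "\<lbrakk>\<And>n. s n \<in> Qp v; \<forall>e>0. \<exists>N. \<forall>m\<ge>N. \<forall>n\<ge>N. v (s m - s n) < e\<rbrakk>
        \<Longrightarrow> \<exists>l\<in>Qp v. (\<lambda>n. v (s n - l)) \<longlonglongrightarrow> 0"
    and alg_closure_Qp: "algebraic_closure (ring_of_type_algebra :: 'k ring) (Qp v)"

definition Qp_adjoin :: "('k::field_char_0 \<Rightarrow> real) \<Rightarrow> 'k \<Rightarrow> 'k set" where
  "Qp_adjoin v x = generate_field ring_of_type_algebra (insert x (Qp v))"

definition coherent_roots :: "('k::field_char_0 \<Rightarrow> 'k) \<Rightarrow> (nat \<Rightarrow> 'k) \<Rightarrow> bool" where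
  "coherent_roots f \<omega> \<longleftrightarrow> \<omega> 0 = 0 \<and> \<omega> 1 \<noteq> 0 \<and> (\<forall>i\<ge>1. f (\<omega> i) = \<omega> (i - 1))"


section \<open>Robba rings\<close>

text \<open>
  A Laurent series is represented by its coefficient function \<open>int \<Rightarrow> 'k\<close>. The coefficients of a
  product are sums over all integers, converging with respect to \<open>v\<close>.
\<close>

definition v_infsum :: "('k::field_char_0 \<Rightarrow> real) \<Rightarrow> (int \<Rightarrow> 'k) \<Rightarrow> 'k" where
  "v_infsum v c = (THE s. ((\<lambda>F. v (s - sum c F)) \<longlongrightarrow> 0) (finite_subsets_at_top UNIV))"

definition laurent_ring ::
    "('k::field_char_0 \<Rightarrow> real) \<Rightarrow> (int \<Rightarrow> 'k) set \<Rightarrow> (int \<Rightarrow> 'k) ring" where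
  "laurent_ring v S =
     \<lparr>carrier = S,
      monoid.mult = (\<lambda>a b n. v_infsum v (\<lambda>k. a k * b (n - k))),
      one = (\<lambda>n. if n = 0 then 1 else 0),
      ring.zero = (\<lambda>n. 0),
      add = (\<lambda>a b n. a n + b n)\<rparr>"

text \<open>
  The usual Robba ring consists of the series converging on some annulus \<open>\<alpha> \<le> |X| < 1\<close>.
  The definition is also found with \<open>n \<rightarrow> +\<infinity>\<close> and \<open>n \<rightarrow> -\<infinity>\<close> interchanged; taken literally this
  describes the series converging on some punctured disc \<open>0 < |X| \<le> \<alpha>\<close>. Both rings are provided.
\<close>

definition robba_ring ::
    "('k::field_char_0 \<Rightarrow> real) \<Rightarrow> 'k set \<Rightarrow> (int \<Rightarrow> 'k) ring" where
  "robba_ring v L = laurent_ring v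
     {a. (\<forall>n. a n \<in> L) \<and>
         (\<forall>\<rho>. 0 < \<rho> \<and> \<rho> < 1 \<longrightarrow> ((\<lambda>n. v (a n) * \<rho> powi n) \<longlongrightarrow> 0) at_top) \<and>
         (\<exists>\<alpha>. 0 < \<alpha> \<and> \<alpha> < 1 \<and> ((\<lambda>n. v (a n) * \<alpha> powi n) \<longlongrightarrow> 0) at_bot)}"

definition robba_ring_at_0 ::
    "('k::field_char_0 \<Rightarrow> real) \<Rightarrow> 'k set \<Rightarrow> (int \<Rightarrow> 'k) ring" where
  "robba_ring_at_0 v L = laurent_ring v
     {a. (\<forall>n. a n \<in> L) \<and>
         (\<exists>\<alpha>. 0 < \<alpha> \<and> \<alpha> < 1 \<and> ((\<lambda>n. v (a n) * \<alpha> powi n) \<longlongrightarrow> 0) at_top) \<and>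
         (\<forall>\<rho>. 0 < \<rho> \<and> \<rho> < 1 \<longrightarrow> ((\<lambda>n. v (a n) * \<rho> powi n) \<longlongrightarrow> 0) at_bot)}"

definition laurent_monom :: "'k::field_char_0 \<Rightarrow> nat \<Rightarrow> int \<Rightarrow> 'k" where
  "laurent_monom c m = (\<lambda>n. if n = int m then c else 0)"

text \<open>The derivation \<open>X d/dX\<close>.\<close>

definition X_deriv :: "(int \<Rightarrow> 'k::field_char_0) \<Rightarrow> int \<Rightarrow> 'k" where
  "X_deriv a = (\<lambda>n. of_int n * a n)"


section \<open>Absolute Frobenius\<close>

text \<open>
  The last condition says that \<open>\<sigma>\<close> induces \<open>x \<mapsto> x ^ p\<close> on the residue field
  \<open>{x \<in> L. |x| \<le> 1} / {x \<in> L. |x| < 1}\<close>.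
\<close>

definition frobenius_lift ::
    "nat \<Rightarrow> ('k::field_char_0 \<Rightarrow> real) \<Rightarrow> 'k set \<Rightarrow> ('k \<Rightarrow> 'k) \<Rightarrow> bool" where
  "frobenius_lift p v L \<sigma> \<longleftrightarrow>
     \<sigma> \<in> ring_iso (ring_of_type_algebra\<lparr>carrier := L\<rparr>) (ring_of_type_algebra\<lparr>carrier := L\<rparr>) \<and>
     (\<forall>x\<in>Qp v. \<sigma> x = x) \<and>
     (\<forall>x\<in>L. \<forall>e>0. \<exists>d>0. \<forall>y\<in>L. v (y - x) < d \<longrightarrow> v (\<sigma> y - \<sigma> x) < e) \<and>
     (\<forall>x\<in>L. v x \<le> 1 \<longrightarrow> v (\<sigma> x - x ^ p) < 1)"

definition absolute_frobenius ::
    "nat \<Rightarrow> ('k::field_char_0 \<Rightarrow> real) \<Rightarrow> 'k set \<Rightarrow> ((int \<Rightarrow> 'k) \<Rightarrow> int \<Rightarrow> 'k) \<Rightarrow> bool" where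
  "absolute_frobenius p v L \<phi> \<longleftrightarrow>
     (\<exists>\<sigma>. frobenius_lift p v L \<sigma> \<and>
       \<phi> = (\<lambda>a n. if int p dvd n then \<sigma> (a (n div int p)) else 0))"


section \<open>Differential modules over a ring of Laurent series\<close>

definition differential_module ::
    "(int \<Rightarrow> 'k::field_char_0) ring \<Rightarrow> (int \<Rightarrow> 'k, 'm) module \<Rightarrow> ('m \<Rightarrow> 'm) \<Rightarrow> bool" where
  "differential_module R M D \<longleftrightarrow>
     module R M \<and>
     D \<in> carrier M \<rightarrow> carrier M \<and>
     (\<forall>m\<in>carrier M. \<forall>m'\<in>carrier M. D (m \<oplus>\<^bsub>M\<^esub> m') = D m \<oplus>\<^bsub>M\<^esub> D m') \<and>
     (\<forall>a\<in>carrier R. \<forall>m\<in>carrier M.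
        D (a \<odot>\<^bsub>M\<^esub> m) = a \<odot>\<^bsub>M\<^esub> D m \<oplus>\<^bsub>M\<^esub> X_deriv a \<odot>\<^bsub>M\<^esub> m)"

definition differential_module_iso ::
    "(int \<Rightarrow> 'k::field_char_0) ring \<Rightarrow> (int \<Rightarrow> 'k, 'm) module \<Rightarrow> ('m \<Rightarrow> 'm)
      \<Rightarrow> (int \<Rightarrow> 'k, 'n) module \<Rightarrow> ('n \<Rightarrow> 'n) \<Rightarrow> ('m \<Rightarrow> 'n) \<Rightarrow> bool" where
  "differential_module_iso R M D N E h \<longleftrightarrow>
     bij_betw h (carrier M) (carrier N) \<and>
     (\<forall>m\<in>carrier M. \<forall>m'\<in>carrier M. h (m \<oplus>\<^bsub>M\<^esub> m') = h m \<oplus>\<^bsub>N\<^esub> h m') \<and>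
     (\<forall>a\<in>carrier R. \<forall>m\<in>carrier M. h (a \<odot>\<^bsub>M\<^esub> m) = a \<odot>\<^bsub>N\<^esub> h m) \<and>
     (\<forall>m\<in>carrier M. h (D m) = E (h m))"

text \<open>\<open>(M, D)\<close> is free of rank one and defined by the operator \<open>X_deriv - g\<close>.\<close>

definition defined_by ::
    "(int \<Rightarrow> 'k::field_char_0) ring \<Rightarrow> (int \<Rightarrow> 'k) \<Rightarrow> (int \<Rightarrow> 'k, 'm) module \<Rightarrow> ('m \<Rightarrow> 'm) \<Rightarrow> bool"
  where
  "defined_by R g M D \<longleftrightarrow>
     g \<in> carrier R \<and> differential_module R M D \<and>
     (\<exists>\<epsilon>\<in>carrier M.
        (\<forall>m\<in>carrier M. \<exists>!a. a \<in> carrier R \<and> m = a \<odot>\<^bsub>M\<^esub> \<epsilon>) \<and>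
        D \<epsilon> = g \<odot>\<^bsub>M\<^esub> \<epsilon>)"

text \<open>\<open>(N, E)\<close> belongs to the isomorphism class \<open>\<phi>\<^sup>*(M, D)\<close>.\<close>

definition frobenius_pullback ::
    "nat \<Rightarrow> (int \<Rightarrow> 'k::field_char_0) ring \<Rightarrow> ((int \<Rightarrow> 'k) \<Rightarrow> int \<Rightarrow> 'k)
      \<Rightarrow> (int \<Rightarrow> 'k, 'm) module \<Rightarrow> ('m \<Rightarrow> 'm) \<Rightarrow> (int \<Rightarrow> 'k, 'm) module \<Rightarrow> ('m \<Rightarrow> 'm) \<Rightarrow> bool" where
  "frobenius_pullback p R \<phi> M D N E \<longleftrightarrow>
     (\<exists>g. defined_by R g M D \<and> defined_by R (\<lambda>n. of_nat p * \<phi> g n) N E)"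

definition has_frobenius_structure ::
    "nat \<Rightarrow> ('k::field_char_0 \<Rightarrow> real) \<Rightarrow> 'k set \<Rightarrow> (int \<Rightarrow> 'k) ring
      \<Rightarrow> (int \<Rightarrow> 'k, 'm) module \<Rightarrow> ('m \<Rightarrow> 'm) \<Rightarrow> bool" where
  "has_frobenius_structure p v L R M D \<longleftrightarrow>
     (\<exists>\<phi> N E h. absolute_frobenius p v L \<phi> \<and> frobenius_pullback p R \<phi> M D N E \<and>
        differential_module_iso R M D N E h)"

end

theory Submission
  imports Defs "HOL-Number_Theory.Residues"
begin

text \<open>
  Put \<open>G = \<Sum> \<omega>\<^sub>n\<^sub>-\<^sub>i X^(p^i) / p^i\<close>, so that the module is defined by \<open>\<partial> - \<partial>G\<close>. It becomes trivial on
  the whole open unit disc: \<open>exp G\<close> and \<open>exp (- G)\<close> have integral coefficients. Indeed, for an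
  indeterminate \<open>t\<close> the series \<open>F\<^sub>t = exp (\<Sum> f^i(t) X^(p^i) / p^i)\<close> satisfies
  \<open>F\<^sub>f\<^sub>(\<^sub>t\<^sub>)(X^p) = F\<^sub>t(X)^p exp (- p t X)\<close>, and since \<open>t \<mapsto> f(t)\<close> lifts the Frobenius of \<open>\<int>\<^sub>p[t]\<close>, Dwork's
  lemma shows that its coefficients lie in \<open>\<int>\<^sub>p[t]\<close>; now set \<open>t = \<plusminus> \<omega>\<^sub>n\<close>.

  As \<open>\<rat>\<^sub>p(\<omega>\<^sub>n)\<close> is totally ramified over \<open>\<rat>\<^sub>p\<close>, the identity is a Frobenius lift, and
  \<open>exp (G(X^p) - G)\<close> carries a basis of the module to a basis of its pullback. This element lies in
  both versions of the Robba ring.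
\<close>

unbundle no vec_syntax
unbundle fps_syntax

section \<open>The absolute value\<close>

text \<open>Fermat's little theorem, carried to integers of either sign by passing to the natural
  residue \<open>a\<close>; it yields the residue field of Q_p below.\<close>

lemma int_power_prime_cong:
  fixes m :: int
  assumes "Factorial_Ring.prime q"
  shows "[m ^ q = m] (mod int q)"
proof -
  have "q > 0"
    using assms prime_gt_0_nat by blast
  define a where "a = nat (m mod int q)"
  have "[a ^ q = a] (mod q)"
  proof (cases "q dvd a")
    case True
    then show ?thesis
      using \<open>q > 0\<close> by (meson cong_0_iff cong_sym cong_trans dvd_power_iff_le dvd_trans dvd_power)
  next
    case False
    then have "[a * a ^ (q - 1) = a * 1] (mod q)"
      using fermat_theorem[OF assms False] by (intro cong_mult) auto
    then show ?thesis
      using \<open>q > 0\<close> by (simp flip: power_Suc)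
  qed
  then have "[int a ^ q = int a] (mod int q)"
    by (metis cong_int_iff of_nat_power)
  moreover have "[m = int a] (mod int q)"
    using \<open>q > 0\<close> by (simp add: a_def cong_def)
  ultimately show ?thesis
    by (meson cong_pow cong_sym cong_trans)
qed

context padic_algebraic_closure
begin

section \<open>Ultrametric estimates and the absolute value on the integers\<close>

lemma p_gt_1: "p > 1"
  using prime_p prime_gt_1_nat by blast

lemma v_0 [simp]: "v 0 = 0"
  using v_eq_0_iff by blast

lemma v_1 [simp]: "v 1 = 1"
  using v_mult[of 1 1] v_eq_0_iff[of 1] by auto

lemma v_minus [simp]: "v (- x) = v x"
proof -
  have "v (-1) ^ 2 = 1"
    using v_mult[of "-1" "-1"] by (simp add: power2_eq_square)
  then have "v (-1) = 1"
    using v_nonneg[of "-1"] by (auto simp: power2_eq_1_iff)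
  then show ?thesis
    using v_mult[of "-1" x] by simp
qed

lemma v_diff_le: "v (x - y) \<le> max (v x) (v y)"
  using v_add_le[of x "- y"] by simp

lemma v_diff_commute: "v (x - y) = v (y - x)"
  by (metis minus_diff_eq v_minus)

lemma v_power: "v (x ^ n) = v x ^ n"
  by (induction n) (auto simp: v_mult)

lemma v_inverse: "v (inverse x) = inverse (v x)"
proof (cases "x = 0")
  case False
  then have "v x * v (inverse x) = 1"
    using v_mult[of x "inverse x"] by simp
  then show ?thesis
    using inverse_unique by metis
qed simp

lemma v_divide: "v (x / y) = v x / v y"
  by (simp add: divide_inverse v_mult v_inverse)

text \<open>From \<open>y = (x + y) - x\<close>, the larger value \<open>v y\<close> is bounded by
  the maximum of \<open>v (x + y)\<close> and \<open>v x\<close>, and \<open>v x\<close> is too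
  small to reach it.\<close>

lemma v_add_eq: "v x < v y \<Longrightarrow> v (x + y) = v y"
  using v_add_le[of x y] v_diff_le[of "x + y" x] by (auto simp: max_def split: if_splits)

lemma v_sum_le:
  assumes "\<And>i. i \<in> A \<Longrightarrow> v (f i) \<le> B" and "B \<ge> 0"
  shows "v (sum f A) \<le> B"
  using assms(1)
proof (induction A rule: infinite_finite_induct)
  case (insert x A)
  then show ?case
    using v_add_le[of "f x" "sum f A"] by (auto simp: max_def split: if_splits intro: order_trans)
qed (use assms(2) in auto)

lemma v_of_nat_le_1: "v (of_nat n) \<le> 1"
proof (induction n)
  case (Suc n)
  then show ?case
    using v_add_le[of 1 "of_nat n"] by simp
qed simp

lemma v_of_int_le_1: "v (of_int k) \<le> 1"
proof (cases "k \<ge> 0")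
  case True
  then show ?thesis
    using v_of_nat_le_1[of "nat k"] by simp
next
  case False
  then show ?thesis
    using v_of_nat_le_1[of "nat (- k)"] by simp
qed

lemma v_of_int_dvd:
  assumes "int p dvd k"
  shows "v (of_int k) \<le> 1 / real p"
proof -
  obtain j where "k = int p * j"
    using assms by blast
  then have "v (of_int k) = 1 / real p * v (of_int j)"
    by (simp add: v_mult v_p)
  then show ?thesis
    using v_of_int_le_1[of j] by (simp add: divide_le_cancel)
qed

text \<open>A Bezout relation between \<open>p\<close> and \<open>k\<close> would otherwise write 1
  as a sum of two terms of absolute value below 1.\<close>

lemma v_of_int_not_dvd:
  assumes "\<not> int p dvd k"
  shows "v (of_int k) = 1"
proof (rule ccontr)
  assume "v (of_int k) \<noteq> 1"
  then have less: "v (of_int k) < 1"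
    using v_of_int_le_1[of k] by simp
  have "coprime (int p) k"
    using assms prime_p by (simp add: prime_imp_coprime)
  then obtain a b where ab: "a * int p + b * k = 1"
    by (metis bezout_int coprime_imp_gcd_eq_1)
  have "1 = v (of_int (a * int p + b * k))"
    unfolding ab by simp
  also have "\<dots> \<le> max (v (of_int a) * v (of_nat p)) (v (of_int b) * v (of_int k))"
    using v_add_le by (simp add: v_mult[symmetric])
  also have "\<dots> < 1"
    using mult_left_le_one_le[of "v (of_nat p)" "v (of_int a)"]
      mult_left_le_one_le[of "v (of_int k)" "v (of_int b)"]
      v_of_int_le_1[of a] v_of_int_le_1[of b] v_nonneg less p_gt_1
    by (auto simp: v_p intro: le_less_trans)
  finally show False
    by simp
qed

lemma v_of_nat_not_dvd: "\<not> p dvd n \<Longrightarrow> v (of_nat n) = 1"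
  using v_of_int_not_dvd[of "int n"] by simp

text \<open>The cofactor of \<open>x - y\<close> in \<open>x ^ n - y ^ n\<close> is a sum of
  products of integral elements.\<close>

lemma v_power_diff_le:
  assumes "v x \<le> 1" "v y \<le> 1"
  shows "v (x ^ n - y ^ n) \<le> v (x - y)"
proof -
  have "v (\<Sum>i<n. y ^ (n - Suc i) * x ^ i) \<le> 1"
    by (rule v_sum_le)
      (use assms v_nonneg in \<open>auto simp: v_mult v_power intro!: mult_le_one power_le_one\<close>)
  then show ?thesis
    using v_nonneg[of "x - y"] mult_left_le[of "v (\<Sum>i<n. y ^ (n - Suc i) * x ^ i)" "v (x - y)"]
    by (simp add: power_diff_sumr2 v_mult)
qed

lemma v_int_value:
  assumes "k \<noteq> 0"
  obtains m where "v (of_int k) = 1 / real p ^ m"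
proof -
  have "\<not> is_unit (int p)"
    using p_gt_1 by auto
  then obtain y where y: "k = int p ^ multiplicity (int p) k * y" "\<not> int p dvd y"
    using multiplicity_decompose'[of k "int p"] assms by metis
  have "of_int k = (of_nat p ^ multiplicity (int p) k * of_int y :: 'k)"
    by (subst y(1)) simp
  then have "v (of_int k) = 1 / real p ^ multiplicity (int p) k"
    by (simp add: v_mult v_power v_p v_of_int_not_dvd[OF y(2)] power_one_over)
  then show thesis
    using that by blast
qed

section \<open>Absolute values of factorials\<close>

lemma v_fact_block:
  assumes "r < p"
  shows "v (fact (p * q + r)) = v (fact (p * q))"
  using assms
proof (induction r)
  case (Suc r)
  have "\<not> p dvd p * q + Suc r"
    using Suc.prems by (meson dvd_add_right_iff dvd_triv_left nat_dvd_not_less zero_less_Suc)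
  then have "v (of_nat (p * q + Suc r)) = 1"
    by (rule v_of_nat_not_dvd)
  moreover have "fact (p * q + Suc r) = (of_nat (p * q + Suc r) * fact (p * q + r) :: 'k)"
    by simp
  ultimately show ?case
    using Suc by (simp only: v_mult)
qed simp

text \<open>Legendre's formula in recursive form: each block of \<open>p\<close> consecutive factors
  contains one multiple of \<open>p\<close>, and these multiples are \<open>p\<close> times the
  factors of \<open>fact q\<close>.\<close>

lemma v_fact_mult: "v (fact (p * q)) = v (fact q) / real p ^ q"
proof (induction q)
  case (Suc q)
  have "p * Suc q = Suc (p * q + (p - 1))"
    using p_gt_1 by simp
  then have "fact (p * Suc q) = (of_nat (p * Suc q) * fact (p * q + (p - 1)) :: 'k)"
    by (simp only: fact_Suc)
  then have "v (fact (p * Suc q)) = v (of_nat p) * v (of_nat (Suc q)) * v (fact (p * q + (p - 1)))"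
    by (simp only: v_mult of_nat_mult)
  also have "v (fact (p * q + (p - 1))) = v (fact (p * q))"
    using v_fact_block[of "p - 1" q] p_gt_1 by simp
  also have "v (of_nat p) * v (of_nat (Suc q)) * v (fact (p * q))
      = v (of_nat (Suc q)) * v (fact (p * q)) / real p"
    by (simp only: v_p) simp
  also have "\<dots> = v (of_nat (Suc q) * fact q) / real p ^ Suc q"
    by (simp only: Suc v_mult) simp
  finally show ?case
    by (simp only: fact_Suc)
qed simp

text \<open>By Legendre's recursion \<open>p\<close> divides n! at most n - 1 times. Hence the
  nonconstant coefficients of exp(p t X) stay integral for integral t even after division by
  \<open>p\<close>, as Dwork's lemma requires.\<close>

lemma v_power_div_fact_le_1:
  assumes "n > 0"
  shows "v (of_nat p ^ (n - 1) / fact n) \<le> 1"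
proof -
  have "1 / real p ^ (n - 1) \<le> v (fact n)"
    using assms
  proof (induction n rule: less_induct)
    case (less n)
    define q where "q = n div p"
    have n: "n = p * q + n mod p"
      by (simp add: q_def)
    have v: "v (fact n) = v (fact q) / real p ^ q"
      using p_gt_1 v_fact_block[of "n mod p" q] by (subst n) (simp add: v_fact_mult)
    show ?case
    proof (cases "q = 0")
      case True
      then show ?thesis
        using v p_gt_1 by simp
    next
      case False
      \<comment> \<open>As \<open>p\<close> is at least 2 and \<open>q\<close> is positive, the
        exponent (q - 1) + q from the recursion is at most n - 1.\<close>
      have qn: "q < n" "2 * q \<le> n"
        using p_gt_1 less.prems n mult_le_mono1[of 2 p q] False by (simp add: q_def, linarith)
      have "1 / real p ^ (n - 1) \<le> 1 / real p ^ ((q - 1) + q)"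
        using p_gt_1 qn False by (intro divide_left_mono power_increasing) auto
      also have "\<dots> = (1 / real p ^ (q - 1)) / real p ^ q"
        by (simp add: power_add)
      also have "\<dots> \<le> v (fact q) / real p ^ q"
        using less.IH[of q] qn False by (intro divide_right_mono) auto
      finally show ?thesis
        using v by simp
    qed
  qed
  moreover have "v (fact n :: 'k) > 0"
    using v_nonneg v_eq_0_iff by (metis fact_nonzero less_eq_real_def)
  moreover have "real p ^ (n - 1) > 0"
    using p_gt_1 by simp
  ultimately have "1 \<le> v (fact n) * real p ^ (n - 1)"
    by (simp add: pos_divide_le_eq)
  then show ?thesis
    using \<open>v (fact n) > 0\<close> \<open>real p ^ (n - 1) > 0\<close>
    by (simp add: v_divide v_power v_p power_one_over pos_divide_le_eq mult.commute)
qed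

lemma subfield_Qp: "subfield (Qp v) (ring_of_type_algebra :: 'k ring)"
  using alg_closure_Qp by (simp add: algebraic_closure_def)

end

section \<open>Subfields in terms of the type class operations\<close>

lemma ring_of_type_algebra_simps [simp]:
  "carrier (ring_of_type_algebra :: 'k::field ring) = UNIV"
  "x \<otimes>\<^bsub>(ring_of_type_algebra :: 'k::field ring)\<^esub> y = x * y"
  "x \<oplus>\<^bsub>(ring_of_type_algebra :: 'k::field ring)\<^esub> y = x + y"
  "\<one>\<^bsub>(ring_of_type_algebra :: 'k::field ring)\<^esub> = 1"
  "\<zero>\<^bsub>(ring_of_type_algebra :: 'k::field ring)\<^esub> = 0"
  by (simp_all add: ring_of_type_algebra_def)

lemma ring_of_type_algebra_inv [simp]:
  fixes x :: "'k :: field"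
  shows "\<ominus>\<^bsub>ring_of_type_algebra\<^esub> x = - x"
    "x \<noteq> 0 \<Longrightarrow> inv\<^bsub>ring_of_type_algebra\<^esub> x = inverse x"
proof -
  interpret R: field "ring_of_type_algebra :: 'k ring"
    by (rule field_from_type_algebra)
  show "\<ominus>\<^bsub>ring_of_type_algebra\<^esub> x = - x"
    using R.minus_equality[of "- x" x] by simp
  show "inv\<^bsub>ring_of_type_algebra\<^esub> x = inverse x" if "x \<noteq> 0"
    using R.inv_char[of x "inverse x"] that by simp
qed

text \<open>Stated with the type class operations so that coefficients can be handled outside the
  algebraic record. Since \<open>inverse 0 = 0\<close>, closure under inverses needs no
  exception.\<close>

definition is_subfield :: "'k::field set \<Rightarrow> bool" where
  "is_subfield L \<longleftrightarrow> 0 \<in> L \<and> 1 \<in> L \<and> (\<forall>x\<in>L. - x \<in> L \<and> inverse x \<in> L) \<and>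
     (\<forall>x\<in>L. \<forall>y\<in>L. x + y \<in> L \<and> x * y \<in> L)"

lemma is_subfieldD:
  assumes "is_subfield L"
  shows "0 \<in> L" "1 \<in> L" "x \<in> L \<Longrightarrow> - x \<in> L" "x \<in> L \<Longrightarrow> inverse x \<in> L"
    "x \<in> L \<Longrightarrow> y \<in> L \<Longrightarrow> x + y \<in> L" "x \<in> L \<Longrightarrow> y \<in> L \<Longrightarrow> x - y \<in> L"
    "x \<in> L \<Longrightarrow> y \<in> L \<Longrightarrow> x * y \<in> L" "x \<in> L \<Longrightarrow> y \<in> L \<Longrightarrow> x / y \<in> L"
    "x \<in> L \<Longrightarrow> x ^ n \<in> L" "of_nat n \<in> L" "(\<And>i. i \<in> A \<Longrightarrow> f i \<in> L) \<Longrightarrow> sum f A \<in> L"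
proof -
  show B: "0 \<in> L" "1 \<in> L" "x \<in> L \<Longrightarrow> - x \<in> L" "x \<in> L \<Longrightarrow> inverse x \<in> L"
    and C: "x \<in> L \<Longrightarrow> y \<in> L \<Longrightarrow> x + y \<in> L" "x \<in> L \<Longrightarrow> y \<in> L \<Longrightarrow> x * y \<in> L" for x y
    using assms by (auto simp: is_subfield_def)
  show "x \<in> L \<Longrightarrow> y \<in> L \<Longrightarrow> x - y \<in> L"
    using assms by (metis C(1) diff_conv_add_uminus is_subfield_def)
  show "x \<in> L \<Longrightarrow> y \<in> L \<Longrightarrow> x / y \<in> L"
    using assms by (metis C(2) divide_inverse is_subfield_def)
  show "x \<in> L \<Longrightarrow> x ^ n \<in> L"
    by (induction n) (auto simp: B C)
  show "of_nat n \<in> L"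
    by (induction n) (auto simp: B C)
  show "(\<And>i. i \<in> A \<Longrightarrow> f i \<in> L) \<Longrightarrow> sum f A \<in> L"
    by (induction A rule: infinite_finite_induct) (auto simp: B C)
qed

lemma subfield_imp_is_subfield:
  fixes L :: "'k::field set"
  assumes "subfield L ring_of_type_algebra"
  shows "is_subfield L"
proof -
  interpret R: field "ring_of_type_algebra :: 'k ring"
    by (rule field_from_type_algebra)
  note sr = subfieldE(1)[OF assms]
  have "inverse x \<in> L" if "x \<in> L" for x
    using R.subfield_m_inv(1)[OF assms, of x] subringE(2)[OF sr] that by (cases "x = 0") auto
  then show ?thesis
    using subringE[OF sr] by (auto simp: is_subfield_def)
qed

context padic_algebraic_closure
begin

lemma is_subfield_Qp: "is_subfield (Qp v)"
  using subfield_Qp by (rule subfield_imp_is_subfield)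

section \<open>Residue field and value group of Q_p\<close>

lemma of_nat_Qp: "of_nat n \<in> Qp v"
  by (rule is_subfieldD[OF is_subfield_Qp])

text \<open>A rational a/b in lowest terms near \<open>c\<close> is integral, so \<open>p\<close>
  does not divide \<open>b\<close>. With \<open>b'\<close> an inverse of \<open>b\<close> modulo
  \<open>p\<close>, the integer \<open>a * b'\<close> is congruent to a/b modulo
  \<open>p\<close>.\<close>

lemma Qp_approx_int:
  assumes "c \<in> Qp v" "v c \<le> 1"
  obtains m :: int where "v (c - of_int m) \<le> 1 / real p"
proof -
  have p0: "1 / real p > 0" "1 / real p < 1"
    using p_gt_1 by auto
  obtain q where q: "q \<in> \<rat>" "v (c - q) < 1 / real p"
    using assms(1) p0(1) unfolding Qp_def by blast
  obtain a b :: int where ab: "b > 0" "coprime a b" "q = of_int a / of_int b"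
    using Rats_cases'[OF q(1)] by metis
  have vq: "v q \<le> 1"
    using v_diff_le[of c "c - q"] assms(2) q(2) p0 by (smt (verit) diff_diff_eq2 add_diff_cancel_left')
  have b: "\<not> int p dvd b"
  proof
    assume b: "int p dvd b"
    then have "\<not> int p dvd a"
      using ab(2) prime_p by (meson coprime_common_divisor not_prime_unit prime_nat_int_transfer)
    then have "v (of_int a) = 1"
      by (rule v_of_int_not_dvd)
    moreover have "v (of_int a) = v q * v (of_int b)"
      using ab by (simp flip: v_mult)
    ultimately show False
      using vq v_of_int_dvd[OF b] p0 v_nonneg
      by (metis less_le_trans linorder_not_less mult_left_le_one_le order_trans)
  qed
  then have "coprime b (int p)"
    using prime_imp_coprime[of "int p" b] prime_p by (simp add: coprime_commute)
  then obtain b' e where b': "b' * b + e * int p = 1"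
    by (metis bezout_int coprime_imp_gcd_eq_1)
  define m where "m = a * b'"
  have "(q - of_int m) * of_int b = of_int a * of_int (1 - b' * b)"
    using ab by (simp add: m_def field_simps)
  also have "\<dots> = of_int (a * e * int p)"
  proof -
    have "1 - b' * b = e * int p"
      using b' by simp
    then show ?thesis
      by (simp only: of_int_mult mult.assoc)
  qed
  finally have "v (q - of_int m) * v (of_int b) = v (of_int (a * e * int p))"
    by (simp only: v_mult[symmetric])
  then have "v (q - of_int m) \<le> 1 / real p"
    using v_of_int_not_dvd[OF b] v_of_int_dvd[of "a * e * int p"] by simp
  then have "v (c - of_int m) \<le> 1 / real p"
    using v_add_le[of "c - q" "q - of_int m"] q(2) by simp
  then show thesis
    using that by blast
qed

text \<open>The residue field of Q_p is the prime field: replace \<open>c\<close> by a nearby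
  integer and apply Fermat.\<close>

lemma Qp_power_p:
  assumes "c \<in> Qp v" "v c \<le> 1"
  shows "v (c ^ p - c) \<le> 1 / real p"
proof -
  obtain m :: int where m: "v (c - of_int m) \<le> 1 / real p"
    using Qp_approx_int assms by blast
  have "[m ^ p = m] (mod int p)"
    using prime_p by (rule int_power_prime_cong)
  then have "int p dvd m ^ p - m"
    by (simp add: cong_iff_dvd_diff)
  then have 1: "v (of_int (m ^ p - m)) \<le> 1 / real p"
    by (rule v_of_int_dvd)
  have 2: "v (c ^ p - of_int m ^ p) \<le> 1 / real p"
    using v_power_diff_le[of c "of_int m" p] assms v_of_int_le_1[of m] m by linarith
  have "c ^ p - c = ((c ^ p - of_int m ^ p) - (c - of_int m)) + of_int (m ^ p - m)"
    by simp
  then show ?thesis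
    using 1 2 m v_add_le v_diff_le by (smt (verit))
qed

text \<open>A rational closer to \<open>c\<close> than \<open>v c\<close> has the same absolute
  value as \<open>c\<close>, so Q_p has the value group of the rationals.\<close>

lemma Qp_value:
  assumes "c \<in> Qp v" "c \<noteq> 0"
  obtains k :: int where "v c = real p powi k"
proof -
  have "v c > 0"
    using assms(2) v_nonneg v_eq_0_iff by (metis less_eq_real_def)
  then obtain q where q: "q \<in> \<rat>" "v (c - q) < v c"
    using assms(1) unfolding Qp_def by blast
  have vq: "v q = v c"
    using v_add_eq[of "q - c" c] q(2) by (simp add: v_diff_commute)
  obtain a b :: int where ab: "b > 0" "q = of_int a / of_int b"
    using Rats_cases'[OF q(1)] by metis
  have "a \<noteq> 0"
    using ab vq \<open>v c > 0\<close> by auto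
  obtain i j where "v (of_int a) = 1 / real p ^ i" "v (of_int b) = 1 / real p ^ j"
    using v_int_value \<open>a \<noteq> 0\<close> ab(1) by (metis less_irrefl)
  then have "v c = real p powi (int j - int i)"
    using vq ab p_gt_1 by (simp add: v_divide power_int_diff)
  then show thesis
    using that by blast
qed

end

section \<open>Integrality of the exponential\<close>

text \<open>In characteristic 0 the equation determines each coefficient from the earlier ones.
  Exponential identities can then be proved by comparing derivatives.\<close>

lemma fps_linear_ode_unique:
  fixes Y Z C :: "'a::field_char_0 fps"
  assumes "fps_deriv Y = C * Y" "fps_deriv Z = C * Z" "Y $ 0 = Z $ 0"
  shows "Y = Z"
proof (rule fps_ext)
  fix n
  show "Y $ n = Z $ n"
  proof (induction n rule: less_induct)
    case (less n)
    show ?case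
    proof (cases n)
      case (Suc m)
      have rec: "of_nat (Suc m) * W $ Suc m = (\<Sum>i=0..m. C $ i * W $ (m - i))"
        if "fps_deriv W = C * W" for W
        using arg_cong[OF that, of "\<lambda>W. W $ m"] by (simp add: fps_mult_nth)
      have "(\<Sum>i=0..m. C $ i * Y $ (m - i)) = (\<Sum>i=0..m. C $ i * Z $ (m - i))"
        using less.IH Suc by (intro sum.cong) auto
      then have "of_nat (Suc m) * Y $ Suc m = of_nat (Suc m) * Z $ Suc m"
        using rec[OF assms(1)] rec[OF assms(2)] by simp
      then show ?thesis
        unfolding Suc mult_cancel_left of_nat_eq_0_iff by simp
    qed (use assms(3) in simp)
  qed
qed

section \<open>Exponentials of power series\<close>

definition fps_exp_compose :: "'a::field_char_0 fps \<Rightarrow> 'a fps" where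
  "fps_exp_compose a = fps_exp 1 oo a"

lemma fps_exp_compose_nth_0 [simp]: "fps_exp_compose a $ 0 = 1"
  by (simp add: fps_exp_compose_def)

lemma fps_deriv_exp_compose:
  assumes "a $ 0 = 0"
  shows "fps_deriv (fps_exp_compose a) = fps_deriv a * fps_exp_compose a"
  using fps_compose_deriv[OF assms, of "fps_exp 1"] by (simp add: fps_exp_compose_def mult.commute)

text \<open>Both sides solve the same linear differential equation with constant term 1.\<close>

lemma fps_exp_compose_add:
  assumes "a $ 0 = 0" "b $ 0 = 0"
  shows "fps_exp_compose (a + b) = fps_exp_compose a * fps_exp_compose b"
  by (rule fps_linear_ode_unique[of _ "fps_deriv (a + b)"])
    (use assms in \<open>auto simp: fps_deriv_exp_compose algebra_simps\<close>)

lemma fps_exp_compose_0 [simp]: "fps_exp_compose 0 = 1"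
  by (simp add: fps_exp_compose_def fps_compose_0_right)

lemma fps_exp_compose_of_nat:
  assumes "a $ 0 = 0"
  shows "fps_exp_compose (of_nat k * a) = fps_exp_compose a ^ k"
proof (induction k)
  case (Suc k)
  then show ?case
    using fps_exp_compose_add[of a "of_nat k * a"] assms by (simp add: algebra_simps)
qed simp

lemma fps_exp_compose_const_mult_X: "fps_exp_compose (fps_const c * fps_X) = fps_exp c"
  by (simp add: fps_exp_compose_def)

lemma fps_exp_compose_compose:
  assumes "a $ 0 = 0" "b $ 0 = 0"
  shows "fps_exp_compose a oo b = fps_exp_compose (a oo b)"
  by (simp add: fps_exp_compose_def fps_compose_assoc[OF assms(2,1)])

text \<open>In \<open>a ^ k - b ^ k = (a - b) * S\<close> the first factor starts at degree
  \<open>m\<close> and \<open>S\<close> has constant term \<open>k\<close>. For \<open>k = p\<close>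
  this isolates \<open>p\<close> times an unknown coefficient.\<close>

lemma fps_power_nth_cong:
  fixes a b :: "'a::comm_ring_1 fps"
  assumes "\<And>i. i < m \<Longrightarrow> a $ i = b $ i" "a $ 0 = 1" "b $ 0 = 1"
  shows "(a ^ k) $ m = (b ^ k) $ m + of_nat k * (a $ m - b $ m)"
proof -
  define S where "S = (\<Sum>i<k. b ^ (k - Suc i) * a ^ i)"
  have S: "S $ 0 = of_nat k"
    by (simp add: S_def fps_sum_nth fps_nth_power_0 assms)
  have "a ^ k - b ^ k = (a - b) * S"
    unfolding S_def by (rule power_diff_sumr2)
  then have "(a ^ k - b ^ k) $ m = (\<Sum>i=0..m. (a - b) $ i * S $ (m - i))"
    by (simp add: fps_mult_nth)
  also have "\<dots> = (\<Sum>i\<in>{m}. (a - b) $ i * S $ (m - i))"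
    by (rule sum.mono_neutral_right) (use assms(1) in auto)
  finally show ?thesis
    using S by (simp add: algebra_simps)
qed

text \<open>
  This is the ring \<open>\<int>\<^sub>p[t, X]\<close>, with a polynomial in \<open>t\<close> represented by the function it
  defines. Unlike the ring of integers of \<open>\<rat>\<^sub>p(\<omega>\<^sub>n)\<close>, it has a lift of the \<open>p\<close>-th power map
  that sends \<open>\<omega>\<^sub>i\<close> to \<open>\<omega>\<^sub>i\<^sub>-\<^sub>1\<close>: substitute \<open>t ^ p + u * p * t\<close> for \<open>t\<close> and \<open>X ^ p\<close> for \<open>X\<close>.
\<close>

inductive_set (in padic_algebraic_closure) integral_family :: "('k \<Rightarrow> 'k fps) set" where
  const: "\<lbrakk>c \<in> Qp v; v c \<le> 1\<rbrakk> \<Longrightarrow> (\<lambda>t. fps_const c) \<in> integral_family"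
| var: "(\<lambda>t. fps_const t) \<in> integral_family"
| X: "(\<lambda>t. fps_X) \<in> integral_family"
| add: "\<lbrakk>G \<in> integral_family; H \<in> integral_family\<rbrakk> \<Longrightarrow> (\<lambda>t. G t + H t) \<in> integral_family"
| mult: "\<lbrakk>G \<in> integral_family; H \<in> integral_family\<rbrakk> \<Longrightarrow> (\<lambda>t. G t * H t) \<in> integral_family"

context padic_algebraic_closure
begin

section \<open>The ring of integral families and its Frobenius lift\<close>

lemma integral_family_of_nat: "(\<lambda>t. of_nat n) \<in> integral_family"
  using integral_family.const[OF of_nat_Qp v_of_nat_le_1, of n] by (simp add: fps_of_nat)

lemma integral_family_uminus:
  assumes "G \<in> integral_family"
  shows "(\<lambda>t. - G t) \<in> integral_family"
proof -
  have "(\<lambda>t. fps_const (-1)) \<in> integral_family"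
    using is_subfieldD(2,3)[OF is_subfield_Qp] by (intro integral_family.const) auto
  from integral_family.mult[OF this assms] show ?thesis
    by (simp flip: fps_const_neg)
qed

lemma integral_family_sum:
  assumes "\<And>i. i \<in> A \<Longrightarrow> G i \<in> integral_family"
  shows "(\<lambda>t. \<Sum>i\<in>A. G i t) \<in> integral_family"
  using assms
proof (induction A rule: infinite_finite_induct)
  case (insert x A)
  then show ?case
    using integral_family.add[of "G x" "\<lambda>t. \<Sum>i\<in>A. G i t"] by simp
qed (use integral_family_of_nat[of 0] in simp_all)

lemma integral_family_power:
  assumes "G \<in> integral_family"
  shows "(\<lambda>t. G t ^ n) \<in> integral_family"
proof (induction n)
  case (Suc n)
  then show ?case
    using integral_family.mult[OF assms] by simp
qed (use integral_family_of_nat[of 1] in simp)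

text \<open>Coefficients with respect to X are integral polynomials in t; regarding them as constant
  series lets them be used again as elements of the same ring.\<close>

lemma integral_family_nth:
  assumes "G \<in> integral_family"
  shows "(\<lambda>t. fps_const (G t $ m)) \<in> integral_family"
  using assms
proof (induction arbitrary: m rule: integral_family.induct)
  case (const c)
  then show ?case
    using integral_family.const[of c] integral_family_of_nat[of 0] by (cases m) auto
next
  case var
  then show ?case
    using integral_family.var integral_family_of_nat[of 0] by (cases m) auto
next
  case X
  then show ?case
    using integral_family_of_nat[of 0] integral_family_of_nat[of 1] by (cases "m = 1") auto
next
  case (add G H)
  then show ?case
    using integral_family.add[OF add.IH(1)[of m] add.IH(2)[of m]] by simp
next
  case (mult G H)
  have "(\<lambda>t. \<Sum>i=0..m. fps_const (G t $ i) * fps_const (H t $ (m - i))) \<in> integral_family"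
    using mult.IH by (intro integral_family_sum integral_family.mult)
  moreover have "fps_const ((G t * H t) $ m) = (\<Sum>i=0..m. fps_const (G t $ i) * fps_const (H t $ (m - i)))" for t
    by (rule fps_ext) (simp add: fps_mult_nth fps_sum_nth)
  ultimately show ?case
    by simp
qed

text \<open>Specialisation at a point of the closed unit disc turns membership in the polynomial
  ring into a bound in the field.\<close>

lemma v_integral_family_le_1:
  assumes "G \<in> integral_family" "v t \<le> 1"
  shows "v (G t $ m) \<le> 1"
  using assms(1)
proof (induction arbitrary: m rule: integral_family.induct)
  case (add G H)
  then show ?case
    using v_add_le[of "G t $ m" "H t $ m"] by (auto simp: max_def split: if_splits intro: order_trans)
next
  case (mult G H)
  then show ?case
    using v_nonneg by (auto simp: fps_mult_nth v_mult intro!: v_sum_le mult_le_one)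
qed (use assms(2) in \<open>auto simp: fps_X_def\<close>)

text \<open>The inner binomial coefficients are divisible by \<open>p\<close>, and \<open>K\<close>
  collects the quotients. Keeping \<open>K\<close> explicit expresses a congruence modulo
  \<open>p\<close> within the ring.\<close>

lemma integral_family_freshmans_dream:
  assumes "G \<in> integral_family" "H \<in> integral_family"
  obtains K where "K \<in> integral_family"
    "\<And>t. (G t + H t) ^ p = G t ^ p + H t ^ p + of_nat p * K t"
proof -
  define K where
    "K = (\<lambda>t. \<Sum>k\<in>{1..<p}. of_nat ((p choose k) div p) * (G t ^ k * H t ^ (p - k)))"
  have "K \<in> integral_family"
    unfolding K_def using assms
    by (intro integral_family_sum integral_family.mult integral_family_of_nat integral_family_power)
  moreover have "(G t + H t) ^ p = G t ^ p + H t ^ p + of_nat p * K t" for t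
  proof -
    have "(G t + H t) ^ p = (\<Sum>k\<le>p. of_nat (p choose k) * G t ^ k * H t ^ (p - k))"
      by (rule binomial_ring)
    also have "{..p} = insert 0 (insert p {1..<p})"
      by auto
    also have "(\<Sum>k\<in>\<dots>. of_nat (p choose k) * G t ^ k * H t ^ (p - k)) =
        G t ^ p + H t ^ p + (\<Sum>k\<in>{1..<p}. of_nat (p choose k) * G t ^ k * H t ^ (p - k))"
      using p_gt_1 by simp
    also have "(\<Sum>k\<in>{1..<p}. of_nat (p choose k) * G t ^ k * H t ^ (p - k)) =
        (\<Sum>k\<in>{1..<p}. of_nat p * (of_nat ((p choose k) div p) * (G t ^ k * H t ^ (p - k))))"
    proof (rule sum.cong)
      fix k assume "k \<in> {1..<p}"
      then have "p dvd (p choose k)"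
        using prime_p by (intro dvd_choose_prime) auto
      then have "of_nat (p choose k) = (of_nat p * of_nat ((p choose k) div p) :: 'k fps)"
        by (metis dvd_mult_div_cancel of_nat_mult)
      then show "of_nat (p choose k) * G t ^ k * H t ^ (p - k) =
          of_nat p * (of_nat ((p choose k) div p) * (G t ^ k * H t ^ (p - k)))"
        by (simp add: mult.assoc)
    qed simp
    finally show ?thesis
      by (simp add: K_def sum_distrib_left)
  qed
  ultimately show thesis
    using that by blast
qed

text \<open>Modulo \<open>p\<close>, both the p-th power and the substitution respect sums and
  products, so the generators decide: constants by Fermat in Z_p, t because \<open>f t\<close>
  differs from \<open>t ^ p\<close> by \<open>u * p * t\<close>, and X exactly.\<close>

lemma integral_family_frobenius:
  assumes u: "u \<in> Qp v" "v u \<le> 1" and f: "f = (\<lambda>x. x ^ p + u * of_nat p * x)"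
    and "G \<in> integral_family"
  shows "\<exists>K\<in>integral_family. \<forall>t. G t ^ p = (G (f t) oo fps_X ^ p) + of_nat p * K t"
  using assms(4)
proof (induction rule: integral_family.induct)
  case (const c)
  have "(c ^ p - c) / of_nat p \<in> Qp v"
    using const is_subfieldD[OF is_subfield_Qp] of_nat_Qp by simp
  moreover have "v ((c ^ p - c) / of_nat p) \<le> 1"
    using Qp_power_p[OF const] p_gt_1 by (simp add: v_divide v_p field_simps)
  ultimately have "(\<lambda>t. fps_const ((c ^ p - c) / of_nat p)) \<in> integral_family"
    by (rule integral_family.const)
  moreover have "fps_const c ^ p = (fps_const c oo fps_X ^ p) + of_nat p * fps_const ((c ^ p - c) / of_nat p)"
    using p_gt_1 by (simp flip: fps_of_nat add: fps_const_power)
  ultimately show ?case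
    by (intro bexI[where x = "\<lambda>t. fps_const ((c ^ p - c) / of_nat p)"]) simp_all
next
  case var
  have "- u \<in> Qp v" "v (- u) \<le> 1"
    using u is_subfieldD[OF is_subfield_Qp] by simp_all
  then have "(\<lambda>t. fps_const (- u) * fps_const t) \<in> integral_family"
    by (intro integral_family.mult integral_family.const integral_family.var)
  moreover have "fps_const t ^ p = (fps_const (f t) oo fps_X ^ p) + of_nat p * (fps_const (- u) * fps_const t)" for t
    by (simp flip: fps_of_nat add: f fps_const_power)
  ultimately show ?case
    by (intro bexI[where x = "\<lambda>t. fps_const (- u) * fps_const t"]) simp_all
next
  case X
  have "fps_X ^ p = (fps_X oo fps_X ^ p) + of_nat p * (of_nat 0 :: 'k fps)"
    using p_gt_1 by (simp add: fps_X_fps_compose_startby0)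
  then show ?case
    using integral_family_of_nat[of 0] by (intro bexI[where x = "\<lambda>t. of_nat 0"]) simp_all
next
  case (add G H)
  obtain K where K: "K \<in> integral_family" "\<And>t. G t ^ p = (G (f t) oo fps_X ^ p) + of_nat p * K t"
    using add.IH by blast
  obtain L where L: "L \<in> integral_family" "\<And>t. H t ^ p = (H (f t) oo fps_X ^ p) + of_nat p * L t"
    using add.IH by blast
  obtain M where M: "M \<in> integral_family"
    "\<And>t. (G t + H t) ^ p = G t ^ p + H t ^ p + of_nat p * M t"
    using integral_family_freshmans_dream add.hyps by blast
  have "(G t + H t) ^ p = (G (f t) + H (f t) oo fps_X ^ p) + of_nat p * (K t + L t + M t)" for t
    by (simp add: M(2) K(2) L(2) fps_compose_add_distrib algebra_simps)
  moreover have "(\<lambda>t. K t + L t + M t) \<in> integral_family"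
    by (intro integral_family.add K L M)
  ultimately show ?case
    by (intro bexI[where x = "\<lambda>t. K t + L t + M t"]) simp_all
next
  case (mult G H)
  obtain K where K: "K \<in> integral_family" "\<And>t. G t ^ p = (G (f t) oo fps_X ^ p) + of_nat p * K t"
    using mult.IH by blast
  obtain L where L: "L \<in> integral_family" "\<And>t. H t ^ p = (H (f t) oo fps_X ^ p) + of_nat p * L t"
    using mult.IH by blast
  \<comment> \<open>The error term found by expanding the product of
    \<open>G t ^ p - p * K t\<close> and \<open>H t ^ p - p * L t\<close>.\<close>
  define M where "M = (\<lambda>t. G t ^ p * L t + K t * H t ^ p + - (of_nat p * (K t * L t)))"
  have "(fps_X ^ p :: 'k fps) $ 0 = 0"
    using p_gt_1 by simp
  then have "(G t * H t) ^ p = (G (f t) * H (f t) oo fps_X ^ p) + of_nat p * M t" for t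
    by (simp add: M_def power_mult_distrib K(2) L(2) fps_compose_mult_distrib algebra_simps)
  moreover have "M \<in> integral_family"
    unfolding M_def
    by (intro integral_family.add integral_family.mult integral_family_uminus integral_family_power
        integral_family_of_nat mult.hyps K L)
  ultimately show ?case
    by blast
qed

text \<open>Induction on \<open>m\<close>, comparing coefficients of X^m in the functional equation.
  The coefficients below \<open>m\<close> are known to be integral, their contributions to the two
  sides agree modulo \<open>p\<close>, and the unknown one enters only as
  \<open>p * F t $ m\<close>; so division by \<open>p\<close> is possible.\<close>

lemma dwork_lemma:
  assumes u: "u \<in> Qp v" "v u \<le> 1" and f: "f = (\<lambda>x. x ^ p + u * of_nat p * x)"
    and F: "\<And>t. F t $ 0 = 1" "\<And>t. (F (f t) oo fps_X ^ p) = F t ^ p * H t"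
    and H: "\<And>t. H t $ 0 = 1"
      "\<And>m. m > 0 \<Longrightarrow> (\<lambda>t. fps_const (H t $ m / of_nat p)) \<in> integral_family"
  shows "(\<lambda>t. fps_const (F t $ m)) \<in> integral_family"
proof (induction m rule: less_induct)
  case (less m)
  show ?case
  proof (cases "m = 0")
    case True
    then show ?thesis
      using integral_family_of_nat[of 1] F by simp
  next
    case False
    \<comment> \<open>The truncation of \<open>F t\<close> below degree \<open>m\<close>, an
      integral family by the induction hypothesis.\<close>
    define P where "P = (\<lambda>t. \<Sum>j<m. fps_const (F t $ j) * fps_X ^ j)"
    have P: "P \<in> integral_family"
      unfolding P_def using less.IH
      by (intro integral_family_sum integral_family.mult integral_family_power integral_family.X) auto
    have P_nth: "P t $ j = (if j < m then F t $ j else 0)" for t j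
      by (auto simp: P_def fps_sum_nth if_distrib sum.delta cong: if_cong)
    obtain K where K: "K \<in> integral_family"
      "\<And>t. P t ^ p = (P (f t) oo fps_X ^ p) + of_nat p * K t"
      using integral_family_frobenius[OF u f P] by blast
    \<comment> \<open>The coefficient equation at \<open>m\<close>, solved for
      \<open>F t $ m\<close>; the division by \<open>p\<close> is absorbed by \<open>K\<close> and
      by the hypothesis on \<open>H\<close>.\<close>
    define Q where "Q = (\<lambda>t. - fps_const (K t $ m) +
      - (\<Sum>i<m. fps_const ((P t ^ p) $ i) * fps_const (H t $ (m - i) / of_nat p)))"
    have "(\<lambda>t. fps_const ((P t ^ p) $ i) * fps_const (H t $ (m - i) / of_nat p)) \<in> integral_family"
      if "i \<in> {..<m}" for i
      using that
      by (intro integral_family.mult integral_family_nth[OF integral_family_power[OF P]] H(2)) simp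
    from integral_family_sum[OF this]
    have "Q \<in> integral_family"
      unfolding Q_def
      by (intro integral_family.add integral_family_uminus integral_family_nth[OF K(1)])
    moreover have "Q = (\<lambda>t. fps_const (F t $ m))"
    proof
      fix t
      define S where "S = (\<Sum>i<m. (P t ^ p) $ i * H t $ (m - i))"
      have low: "(F t ^ p) $ i = (P t ^ p) $ i" if "i < m" for i
        using fps_power_nth_cong[of i "F t" "P t" p] that False F by (auto simp: P_nth)
      have top: "(F t ^ p) $ m = (P t ^ p) $ m + of_nat p * F t $ m"
        using fps_power_nth_cong[of m "F t" "P t" p] False F by (auto simp: P_nth)
      \<comment> \<open>After the substitution of X^p, the coefficient at \<open>m\<close> only
        involves \<open>F (f t)\<close> at \<open>m div p\<close>, so the truncation gives the same
        value.\<close>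
      have "m div p < m"
        using False p_gt_1 by simp
      then have "(P (f t) oo fps_X ^ p) $ m = (F (f t) oo fps_X ^ p) $ m"
        by (auto simp: fps_nth_compose_X_power P_nth)
      also have "\<dots> = (\<Sum>i=0..m. (F t ^ p) $ i * H t $ (m - i))"
        by (simp add: F fps_mult_nth)
      also have "{0..m} = insert m {..<m}"
        by auto
      also have "(\<Sum>i\<in>\<dots>. (F t ^ p) $ i * H t $ (m - i)) = (F t ^ p) $ m + S"
        by (simp add: H low S_def)
      finally have "(P t ^ p) $ m = (P t ^ p) $ m + of_nat p * F t $ m + S + of_nat p * K t $ m"
        using K(2)[of t] top by (simp flip: fps_of_nat)
      then have "S + of_nat p * (F t $ m + K t $ m) = 0"
        by (simp add: distrib_left add_ac)
      then have "S = of_nat p * - (F t $ m + K t $ m)"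
        by (simp only: eq_neg_iff_add_eq_0 mult_minus_right)
      then have "F t $ m = - K t $ m - S / of_nat p"
        using p_gt_1 by simp
      moreover have "(\<Sum>i<m. fps_const ((P t ^ p) $ i) * fps_const (H t $ (m - i) / of_nat p)) = fps_const (S / of_nat p)"
        by (rule fps_ext) (simp add: fps_sum_nth S_def sum_divide_distrib)
      ultimately show "Q t = fps_const (F t $ m)"
        by (simp add: Q_def)
    qed
    ultimately show ?thesis
      by simp
  qed
qed

end

text \<open>For \<open>p > 1\<close> the index set has at most one element, so this is the sum of
  f^i(t) X^(p^i) / p^i. At t = \<omega>_n it is the polynomial G, since the iterates reach
  0.\<close>

definition lubin_tate_log :: "nat \<Rightarrow> ('k::field_char_0 \<Rightarrow> 'k) \<Rightarrow> 'k \<Rightarrow> 'k fps" where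
  "lubin_tate_log p f t = Abs_fps (\<lambda>m. \<Sum>i | p ^ i = m. (f ^^ i) t / of_nat m)"

lemma lubin_tate_log_nth_power:
  assumes "p > 1"
  shows "lubin_tate_log p f t $ (p ^ i) = (f ^^ i) t / of_nat (p ^ i)"
proof -
  have "{j. p ^ j = p ^ i} = {i}"
    using assms by auto
  then show ?thesis
    by (simp add: lubin_tate_log_def)
qed

lemma lubin_tate_log_nth_other: "(\<And>i. m \<noteq> p ^ i) \<Longrightarrow> lubin_tate_log p f t $ m = 0"
  by (auto simp: lubin_tate_log_def intro: sum.neutral)

lemma lubin_tate_log_nth_0: "p > 1 \<Longrightarrow> lubin_tate_log p f t $ 0 = 0"
  by (rule lubin_tate_log_nth_other) (metis not_one_less_zero power_not_zero)

text \<open>The term of index i at \<open>f t\<close>, taken at X^p, is \<open>p\<close> times the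
  term of index i + 1 at \<open>t\<close>; only the initial term p t X is left over.\<close>

lemma lubin_tate_log_frobenius:
  assumes "p > 1"
  shows "(lubin_tate_log p f (f t) oo fps_X ^ p) =
    of_nat p * lubin_tate_log p f t + fps_const (- (of_nat p * t)) * fps_X"
proof (rule fps_ext)
  fix m
  consider "m = 1" | i where "m = p ^ Suc i" | "\<And>i. m \<noteq> p ^ i"
    by (metis not0_implies_Suc power_0)
  then show "(lubin_tate_log p f (f t) oo fps_X ^ p) $ m =
    (of_nat p * lubin_tate_log p f t + fps_const (- (of_nat p * t)) * fps_X) $ m"
  proof cases
    case 1
    then show ?thesis
      using assms lubin_tate_log_nth_power[of p f t 0]
      by (simp add: fps_nth_compose_X_power flip: fps_of_nat)
  next
    case (2 i)
    then have m: "m \<noteq> 1" "p dvd m" "m div p = p ^ i"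
      using assms by simp_all
    have "lubin_tate_log p f t $ m = (f ^^ i) (f t) / of_nat (p ^ i) / of_nat p"
      using assms lubin_tate_log_nth_power[of p f t "Suc i"] by (simp add: 2 funpow_swap1 mult.commute)
    then show ?thesis
      using assms m lubin_tate_log_nth_power[of p f "f t" i]
      by (simp add: fps_nth_compose_X_power flip: fps_of_nat)
  next
    case 3
    have "lubin_tate_log p f (f t) $ (m div p) = 0" if "p dvd m"
      using 3 that by (intro lubin_tate_log_nth_other) (metis dvd_mult_div_cancel power_Suc)
    then show ?thesis
      using 3 3[of 0] lubin_tate_log_nth_other[OF 3, of f t] lubin_tate_log_nth_0[OF assms, of f "f t"]
      by (simp add: fps_nth_compose_X_power flip: fps_of_nat)
  qed
qed

text \<open>Exponentiating the functional equation of the logarithm gives the situation of Dwork's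
  lemma with quotient exp(-p t X), whose higher coefficients are divisible by \<open>p\<close> by
  the factorial estimate.\<close>

lemma (in padic_algebraic_closure) v_exp_lubin_tate_log_le_1:
  assumes u: "u \<in> Qp v" "v u \<le> 1" and f: "f = (\<lambda>x. x ^ p + u * of_nat p * x)" and t: "v t \<le> 1"
  shows "v (fps_exp_compose (lubin_tate_log p f t) $ m) \<le> 1"
proof -
  let ?F = "\<lambda>t. fps_exp_compose (lubin_tate_log p f t)"
  have "(\<lambda>t. fps_const (?F t $ m)) \<in> integral_family"
  proof (rule dwork_lemma[OF u f])
    show "(?F (f t) oo fps_X ^ p) = ?F t ^ p * fps_exp (- (of_nat p * t))" for t
    proof -
      have X: "(fps_X ^ p :: 'k fps) $ 0 = 0"
        using p_gt_1 by simp
      note log_0 = lubin_tate_log_nth_0[OF p_gt_1]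
      have "(?F (f t) oo fps_X ^ p) = fps_exp_compose (of_nat p * lubin_tate_log p f t + fps_const (- (of_nat p * t)) * fps_X)"
        by (simp only: fps_exp_compose_compose[OF log_0 X] lubin_tate_log_frobenius[OF p_gt_1])
      also have "\<dots> = fps_exp_compose (of_nat p * lubin_tate_log p f t) * fps_exp_compose (fps_const (- (of_nat p * t)) * fps_X)"
        by (rule fps_exp_compose_add) (simp_all add: log_0)
      finally show ?thesis
        by (simp only: fps_exp_compose_of_nat[OF log_0] fps_exp_compose_const_mult_X)
    qed
    fix m :: nat
    assume m: "m > 0"
    \<comment> \<open>Chosen so that \<open>c * (- t) ^ m\<close> is the coefficient of X^m in
      exp(-p t X) divided by \<open>p\<close>.\<close>
    define c where "c = (of_nat p ^ (m - 1) / fact m :: 'k)"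
    have "c = of_nat (p ^ (m - 1)) / of_nat (fact m)"
      by (simp add: c_def)
    then have "c \<in> Qp v"
      using is_subfieldD(8)[OF is_subfield_Qp of_nat_Qp of_nat_Qp] by (simp only:)
    moreover have "v c \<le> 1"
      using v_power_div_fact_le_1[OF m] by (simp add: c_def)
    ultimately have "(\<lambda>t. fps_const c * (- fps_const t) ^ m) \<in> integral_family"
      by (intro integral_family.mult integral_family_power integral_family_uminus
          integral_family.const integral_family.var)
    moreover have "fps_const c * (- fps_const t) ^ m = fps_const (fps_exp (- (of_nat p * t)) $ m / of_nat p)" for t
    proof -
      have "(of_nat p :: 'k) ^ m = of_nat p * of_nat p ^ (m - 1)"
        using m by (metis Suc_diff_1 power_Suc)
      then show ?thesis
        using p_gt_1 by (simp add: c_def fps_const_power power_minus[of "of_nat p * t"] power_minus[of t] power_mult_distrib)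
    qed
    ultimately show "(\<lambda>t. fps_const (fps_exp (- (of_nat p * t)) $ m / of_nat p)) \<in> integral_family"
      by simp
  qed auto
  from v_integral_family_le_1[OF this t, of 0] show ?thesis
    by simp
qed

section \<open>The residue field of a Lubin-Tate extension\<close>

context padic_algebraic_closure
begin

section \<open>Totally ramified extensions have residue field F_p\<close>

lemma v_sum_less:
  assumes "\<And>i. i \<in> A \<Longrightarrow> v (f i) < B" and "B > 0"
  shows "v (sum f A) < B"
  using assms(1)
proof (induction A rule: infinite_finite_induct)
  case (insert x A)
  then have "max (v (f x)) (v (sum f A)) < B"
    by simp
  then show ?case
    using v_add_le[of "f x" "sum f A"] insert.hyps by (simp del: max_less_iff_conj)
qed (use assms(2) in auto)

text \<open>Terms of distinct absolute values cannot cancel, so the largest one gives the value of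
  the sum. The second conjunct carries the induction: a new nonzero term cannot tie with a partial
  sum whose value is that of an earlier term.\<close>

lemma v_le_v_sum:
  assumes "finite A"
    and "\<And>i j. \<lbrakk>i \<in> A; j \<in> A; i \<noteq> j; a i \<noteq> 0; a j \<noteq> 0\<rbrakk> \<Longrightarrow> v (a i) \<noteq> v (a j)"
  shows "(\<forall>i\<in>A. v (a i) \<le> v (sum a A)) \<and>
    (sum a A = 0 \<or> (\<exists>j\<in>A. a j \<noteq> 0 \<and> v (sum a A) = v (a j)))"
  using assms
proof (induction A)
  case (insert x A)
  let ?S = "sum a A"
  have IH: "\<forall>i\<in>A. v (a i) \<le> v ?S" "?S = 0 \<or> (\<exists>j\<in>A. a j \<noteq> 0 \<and> v ?S = v (a j))"
    using insert by (metis insertCI)+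
  consider "a x = 0" | "a x \<noteq> 0" "?S = 0" | "a x \<noteq> 0" "v (a x) < v ?S" | "a x \<noteq> 0" "v ?S < v (a x)"
    using IH(2) insert.prems[of x] insert.hyps(2) by (metis insertCI linorder_neqE)
  then show ?case
  proof cases
    case 1
    then show ?thesis
      using IH insert.hyps v_nonneg by auto
  next
    case 2
    then have "v (a i) \<le> v (a x)" if "i \<in> A" for i
      using IH(1) that v_nonneg by (metis order_trans v_0)
    then show ?thesis
      using 2 insert.hyps by simp
  next
    case 3
    then have "v (sum a (insert x A)) = v ?S"
      using v_add_eq[of "a x" ?S] insert.hyps by simp
    then show ?thesis
      using 3 IH by (metis insert_iff less_eq_real_def v_eq_0_iff v_nonneg not_less)
  next
    case 4
    then have "v (sum a (insert x A)) = v (a x)"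
      using v_add_eq[of ?S "a x"] insert.hyps by (simp add: add.commute)
    then show ?thesis
      using 4 IH by (metis insert_iff less_eq_real_def order_trans)
  qed
qed simp

definition Qp_span :: "nat \<Rightarrow> 'k \<Rightarrow> 'k set" where
  "Qp_span d w = {\<Sum>i<d. c i * w ^ i |c. \<forall>i. c i \<in> Qp v}"

text \<open>Elements of \<open>simple_extension\<close> are built by Horner steps
  \<open>y * w + k\<close>, and the relation for \<open>w ^ d\<close> brings each result back below
  degree \<open>d\<close>. The extension is a field because \<open>w\<close> is algebraic.\<close>

lemma Qp_adjoin_subset_span:
  assumes "d > 0" "w ^ d \<in> Qp_span d w"
  shows "Qp_adjoin v w \<subseteq> Qp_span d w"
proof -
  note K = is_subfieldD[OF is_subfield_Qp]
  interpret A: algebraic_closure "ring_of_type_algebra :: 'k ring" "Qp v"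
    by (rule alg_closure_Qp)
  let ?E = "A.simple_extension (Qp v) w"
  have E: "subfield ?E ring_of_type_algebra"
    using A.simple_extension_is_subfield[OF subfield_Qp, of w] A.algebraic_extension[of w] by simp
  have "insert w (Qp v) \<subseteq> ?E"
    using A.simple_extension_incl[of "Qp v" w] A.simple_extension_mem[OF subfieldE(1)[OF subfield_Qp], of w]
    by auto
  then have "Qp_adjoin v w \<subseteq> ?E"
    unfolding Qp_adjoin_def using A.generate_field_min_subfield1[OF _ E] by simp
  also have "\<dots> \<subseteq> Qp_span d w"
  proof
    fix y assume "y \<in> ?E"
    then show "y \<in> Qp_span d w"
    proof (induction rule: A.simple_extension.induct)
      case zero
      show ?case
        using K(1) by (auto simp: Qp_span_def intro!: exI[of _ "\<lambda>_. 0"])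
    next
      case (lin y k)
      obtain c where c: "\<And>i. c i \<in> Qp v" "y = (\<Sum>i<d. c i * w ^ i)"
        using lin.IH by (auto simp: Qp_span_def)
      obtain e where e: "\<And>i. e i \<in> Qp v" "w ^ d = (\<Sum>i<d. e i * w ^ i)"
        using assms(2) by (auto simp: Qp_span_def)
      obtain m where d: "d = Suc m"
        using assms(1) by (cases d) auto
      \<comment> \<open>Multiplication by \<open>w\<close> shifts the coefficients, \<open>k\<close>
        fills position 0, and the overflow \<open>c m * w ^ d\<close> is expanded by the
        relation.\<close>
      define b where "b = (\<lambda>i. (case i of 0 \<Rightarrow> k | Suc j \<Rightarrow> c j) + c m * e i)"
      have "(\<Sum>i<d. b i * w ^ i) =
          (\<Sum>i<d. (case i of 0 \<Rightarrow> k | Suc j \<Rightarrow> c j) * w ^ i) + c m * w ^ d"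
        by (simp add: b_def e(2) sum.distrib distrib_right sum_distrib_left mult.assoc)
      also have "(\<Sum>i<d. (case i of 0 \<Rightarrow> k | Suc j \<Rightarrow> c j) * w ^ i) = k + (\<Sum>i<m. c i * w ^ Suc i)"
        unfolding d by (subst sum.lessThan_Suc_shift) simp
      also have "k + (\<Sum>i<m. c i * w ^ Suc i) + c m * w ^ d = y * w + k"
        by (simp add: c(2) d sum_distrib_right sum_distrib_left algebra_simps)
      finally have "y * w + k = (\<Sum>i<d. b i * w ^ i)" ..
      moreover have "b i \<in> Qp v" for i
        using K c(1) e(1) lin.hyps(2) by (auto simp: b_def split: nat.split)
      ultimately show ?case
        by (auto simp: Qp_span_def)
    qed
  qed
  finally show ?thesis .
qed

text \<open>By \<open>val\<close> the terms \<open>c i * w ^ i\<close> lie in different classes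
  modulo the value group of Q_p, so integrality of \<open>x\<close> passes to each term. Those with
  positive \<open>i\<close> even have value below 1, leaving \<open>x\<close> congruent to
  \<open>c 0\<close> in Z_p.\<close>

lemma totally_ramified_residue:
  assumes "x \<in> Qp_span d w" "d > 0" "v x \<le> 1"
    and val: "\<And>i k. \<lbrakk>0 < i; i < d\<rbrakk> \<Longrightarrow> v w ^ i \<noteq> real p powi k"
  shows "v (x - x ^ p) < 1"
proof -
  obtain c where c: "\<And>i. c i \<in> Qp v" "x = (\<Sum>i<d. c i * w ^ i)"
    using assms(1) by (auto simp: Qp_span_def)
  let ?a = "\<lambda>i. c i * w ^ i"
  have distinct: "v (?a i) \<noteq> v (?a j)" if "i < j" "j < d" "?a i \<noteq> 0" "?a j \<noteq> 0" for i j
  proof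
    assume eq: "v (?a i) = v (?a j)"
    obtain k l where kl: "v (c i) = real p powi k" "v (c j) = real p powi l"
      using Qp_value c(1) \<open>?a i \<noteq> 0\<close> \<open>?a j \<noteq> 0\<close> by (metis mult_eq_0_iff)
    have "v w \<noteq> 0"
      using \<open>?a j \<noteq> 0\<close> \<open>i < j\<close> by (auto simp: v_eq_0_iff)
    moreover have "v w ^ j = v w ^ i * v w ^ (j - i)"
      using \<open>i < j\<close> by (simp flip: power_add)
    ultimately have "real p powi k = real p powi l * v w ^ (j - i)"
      using eq by (simp add: v_mult v_power kl)
    then have "v w ^ (j - i) = real p powi (k - l)"
      using p_gt_1 by (simp add: power_int_diff field_simps)
    then show False
      using val[of "j - i" "k - l"] \<open>i < j\<close> \<open>j < d\<close> by simp
  qed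
  have "v (?a i) \<noteq> v (?a j)" if "i < d" "j < d" "i \<noteq> j" "?a i \<noteq> 0" "?a j \<noteq> 0" for i j
    using that distinct[of i j] distinct[of j i] by (cases "i < j") auto
  then have "\<forall>i\<in>{..<d}. v (?a i) \<le> v x"
    unfolding c(2) by (intro v_le_v_sum[THEN conjunct1]) auto
  then have le_1: "v (?a i) \<le> 1" if "i < d" for i
    using that assms(3) by (meson lessThan_iff order_trans)
  have less_1: "v (?a i) < 1" if "i \<in> {1..<d}" for i
  proof (cases "c i = 0")
    case False
    then obtain k where k: "v (c i) = real p powi k"
      using Qp_value c(1) by blast
    have "v (?a i) \<noteq> 1"
    proof
      assume "v (?a i) = 1"
      then have "v w ^ i = real p powi (- k)"
        using p_gt_1 by (simp add: v_mult v_power k power_int_minus field_simps)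
      then show False
        using val[of i "- k"] that by simp
    qed
    then show ?thesis
      using le_1[of i] that by simp
  qed simp
  have "{..<d} = insert 0 {1..<d}"
    using assms(2) by auto
  then have "x - c 0 = sum ?a {1..<d}"
    by (simp add: c(2))
  then have 1: "v (x - c 0) < 1"
    using v_sum_less[of "{1..<d}" ?a 1, OF less_1] by simp
  have 2: "v (c 0) \<le> 1"
    using le_1[of 0] assms(2) by simp
  have 3: "v (c 0 - c 0 ^ p) < 1"
    using Qp_power_p[OF c(1) 2] p_gt_1 by (subst v_diff_commute) (simp add: le_less_trans)
  have 4: "v (c 0 ^ p - x ^ p) < 1"
    using v_power_diff_le[OF 2 assms(3), of p] 1 v_diff_commute[of x "c 0"] by simp
  have "x - x ^ p = (x - c 0) + ((c 0 - c 0 ^ p) + (c 0 ^ p - x ^ p))"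
    by simp
  also have "v \<dots> < 1"
    using v_add_le[of "x - c 0" "(c 0 - c 0 ^ p) + (c 0 ^ p - x ^ p)"]
      v_add_le[of "c 0 - c 0 ^ p" "c 0 ^ p - x ^ p"] 1 3 4 by linarith
  finally show ?thesis .
qed

section \<open>Absolute values of the coherent roots\<close>

lemma v_root_of_unity: "u ^ m = 1 \<Longrightarrow> m > 0 \<Longrightarrow> v u = 1"
  using v_power[of u m] power_eq_imp_eq_base[of "v u" m 1] v_nonneg by simp

text \<open>The Newton polygon by hand: the (p-1)-th power of \<omega>_1 is -u p, and at each later
  level the term \<open>x ^ p\<close> dominates the linear one, so absolute values are p-th roots of
  the preceding ones.\<close>

lemma v_coherent_root:
  assumes u: "u ^ (p - 1) = 1" and \<omega>: "coherent_roots (\<lambda>x. x ^ p + u * of_nat p * x) \<omega>"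
  shows "v (\<omega> (Suc i)) ^ (p ^ i * (p - 1)) = 1 / real p"
proof (induction i)
  have u1: "v u = 1"
    using v_root_of_unity[OF u] p_gt_1 by simp
  case 0
  have "\<omega> 1 ^ p + u * of_nat p * \<omega> 1 = 0" "\<omega> 1 \<noteq> 0"
    using \<omega> by (auto simp: coherent_roots_def)
  moreover have "\<omega> 1 ^ p = \<omega> 1 ^ (p - 1) * \<omega> 1"
    using p_gt_1 by (metis Suc_diff_1 less_trans power_Suc2 zero_less_one)
  ultimately have "\<omega> 1 ^ (p - 1) = - (u * of_nat p)"
    by (simp add: eq_neg_iff_add_eq_0 flip: distrib_right)
  then have "v (\<omega> 1) ^ (p - 1) = 1 / real p"
    by (simp add: v_mult u1 v_p flip: v_power)
  then show ?case
    by simp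
next
  have u1: "v u = 1"
    using v_root_of_unity[OF u] p_gt_1 by simp
  case (Suc i)
  define x where "x = \<omega> (Suc (Suc i))"
  define s where "s = v (\<omega> (Suc i))"
  define d where "d = p ^ i * (p - 1)"
  have d: "d > 0" "s ^ d = 1 / real p"
    using Suc p_gt_1 by (auto simp: d_def s_def)
  have x: "x ^ p + u * of_nat p * x = \<omega> (Suc i)"
    using \<omega> by (simp add: coherent_roots_def x_def)
  have v2: "v (u * of_nat p * x) = v x / real p"
    by (simp add: v_mult u1 v_p)
  \<comment> \<open>If the linear term were at least as large, \<open>s\<close> would be below 1/p,
    and so would \<open>s ^ d\<close>, against the induction hypothesis.\<close>
  have "v x / real p < v x ^ p"
  proof (rule ccontr)
    assume "\<not> ?thesis"
    then have le: "v x ^ p \<le> v x / real p"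
      by simp
    then have "s \<le> v x / real p"
      using v_add_le[of "x ^ p" "u * of_nat p * x"] by (simp add: s_def x v2 v_power)
    moreover have "v x < 1"
    proof (rule ccontr)
      assume "\<not> v x < 1"
      then have "v x \<le> v x ^ p"
        using p_gt_1 self_le_power[of "v x" p] by simp
      then have "v x \<le> v x / real p"
        using le by simp
      then show False
        using p_gt_1 \<open>\<not> v x < 1\<close> by (simp add: field_simps)
    qed
    ultimately have "s < 1 / real p"
      using p_gt_1 by (smt (verit) divide_strict_right_mono of_nat_0_less_iff less_trans zero_less_one)
    moreover have "s ^ d \<le> s"
    proof -
      have "s \<le> 1"
        using \<open>s < 1 / real p\<close> p_gt_1 by (smt (verit) divide_le_eq_1 of_nat_1 of_nat_less_iff)
      then show ?thesis
        using power_decreasing[of 1 d s] d v_nonneg by (simp add: s_def)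
    qed
    ultimately show False
      using d by simp
  qed
  then have "s = v x ^ p"
    using v_add_eq[of "u * of_nat p * x" "x ^ p"] v2 by (simp add: s_def x[symmetric] v_power add.commute)
  then have "v x ^ (p * d) = 1 / real p"
    using d by (simp add: power_mult)
  then show ?case
    by (simp add: x_def d_def mult.assoc)
qed

lemma v_coherent_root_le_1:
  assumes "u ^ (p - 1) = 1" "coherent_roots (\<lambda>x. x ^ p + u * of_nat p * x) \<omega>"
  shows "v (\<omega> i) \<le> 1"
proof (cases i)
  case 0
  then show ?thesis
    using assms(2) by (simp add: coherent_roots_def)
next
  case (Suc j)
  show ?thesis
  proof (rule ccontr)
    assume "\<not> v (\<omega> i) \<le> 1"
    then have "1 \<le> v (\<omega> i) ^ (p ^ j * (p - 1))"
      by (intro one_le_power) simp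
    then show False
      using v_coherent_root[OF assms, of j] p_gt_1 Suc by simp
  qed
qed

section \<open>A monic relation over Q_p for each coherent root\<close>

lemma coeff_power_Qp:
  assumes "\<And>i. Polynomial.coeff q i \<in> Qp v"
  shows "Polynomial.coeff (q ^ m) i \<in> Qp v"
proof (induction m arbitrary: i)
  case 0
  then show ?case
    using is_subfieldD(1,2)[OF is_subfield_Qp] by (simp add: coeff_1)
next
  case (Suc m)
  then show ?case
    unfolding power_Suc coeff_mult using assms by (intro is_subfieldD(11,7)[OF is_subfield_Qp])
qed

text \<open>The polynomial is the k-fold iterate of f; its leading term comes from the p-th power
  alone.\<close>

lemma coherent_root_poly:
  assumes "u \<in> Qp v" and \<omega>: "coherent_roots (\<lambda>x. x ^ p + u * of_nat p * x) \<omega>"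
  shows "k \<le> n \<Longrightarrow> \<exists>q. poly q (\<omega> n) = \<omega> (n - k) \<and> Polynomial.degree q = p ^ k \<and>
    Polynomial.coeff q (p ^ k) = 1 \<and> (\<forall>i. Polynomial.coeff q i \<in> Qp v)"
proof (induction k)
  case 0
  show ?case
    using is_subfieldD[OF is_subfield_Qp]
    by (intro exI[of _ "[:0, 1:]"]) (auto simp: coeff_pCons split: nat.split)
next
  case (Suc k)
  then obtain q where q: "poly q (\<omega> n) = \<omega> (n - k)" "Polynomial.degree q = p ^ k"
    "Polynomial.coeff q (p ^ k) = 1" "\<And>i. Polynomial.coeff q i \<in> Qp v"
    by auto
  let ?c = "u * of_nat p"
  let ?q = "q ^ p + Polynomial.smult ?c q"
  have "q \<noteq> 0"
    using q(3) by auto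
  have deg: "Polynomial.degree (q ^ p) = p ^ Suc k"
    using degree_power_eq[OF \<open>q \<noteq> 0\<close>, of p] q(2) by simp
  have less: "Polynomial.degree (Polynomial.smult ?c q) < p ^ Suc k"
    using degree_smult_le[of ?c q] q(2) p_gt_1 by (auto intro: le_less_trans)
  have "Polynomial.coeff (q ^ p) (p ^ Suc k) = 1"
    using lead_coeff_power[of q p] q(2,3) deg by simp
  then have lead: "Polynomial.coeff ?q (p ^ Suc k) = 1"
    using coeff_eq_0[OF less] by simp
  have "Polynomial.coeff ?q i \<in> Qp v" for i
    using q(4) coeff_power_Qp is_subfieldD(5,7)[OF is_subfield_Qp] assms(1) of_nat_Qp by simp
  moreover have "n - k \<ge> 1" "n - k - 1 = n - Suc k"
    using Suc.prems by auto
  then have "poly ?q (\<omega> n) = \<omega> (n - Suc k)"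
    using q(1) \<omega> by (simp add: coherent_roots_def)
  moreover have "Polynomial.degree ?q = p ^ Suc k"
    using degree_add_eq_left[of "Polynomial.smult ?c q" "q ^ p"] less deg by simp
  ultimately show ?case
    using lead by blast
qed

text \<open>Writing \<omega>_1 as a monic polynomial in the root turns the relation between the
  (p-1)-th power of \<omega>_1 and -u p into one whose top power can be solved for.\<close>

lemma coherent_root_power_span:
  assumes "u \<in> Qp v" and \<omega>: "coherent_roots (\<lambda>x. x ^ p + u * of_nat p * x) \<omega>"
  shows "\<omega> (Suc m) ^ (p ^ m * (p - 1)) \<in> Qp_span (p ^ m * (p - 1)) (\<omega> (Suc m))"
proof -
  note K = is_subfieldD[OF is_subfield_Qp]
  obtain q where q: "poly q (\<omega> (Suc m)) = \<omega> 1" "Polynomial.degree q = p ^ m"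
    "Polynomial.coeff q (p ^ m) = 1" "\<And>i. Polynomial.coeff q i \<in> Qp v"
    using coherent_root_poly[OF assms, of m "Suc m"] by auto
  let ?d = "p ^ m * (p - 1)"
  define h where "h = q ^ (p - 1)"
  have h_Qp: "Polynomial.coeff h i \<in> Qp v" for i
    using coeff_power_Qp q(4)
    by (simp add: h_def)
  have "q \<noteq> 0"
    using q(3) by auto
  then have deg: "Polynomial.degree h = ?d"
    using degree_power_eq[of q "p - 1"] q(2) by (simp add: h_def mult.commute)
  have lead: "Polynomial.coeff h ?d = 1"
    using lead_coeff_power[of q "p - 1"] q(2,3) deg by (simp add: h_def)
  have "\<omega> 1 ^ p + u * of_nat p * \<omega> 1 = 0" "\<omega> 1 \<noteq> 0"
    using \<omega> by (auto simp: coherent_roots_def)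
  moreover have "\<omega> 1 ^ p = \<omega> 1 ^ (p - 1) * \<omega> 1"
    using p_gt_1 by (metis Suc_diff_1 less_trans power_Suc2 zero_less_one)
  ultimately have "- (u * of_nat p) = poly h (\<omega> (Suc m))"
    by (simp add: h_def q(1) neg_eq_iff_add_eq_0 add.commute flip: distrib_right)
  also have "\<dots> = (\<Sum>i<?d. Polynomial.coeff h i * \<omega> (Suc m) ^ i) + \<omega> (Suc m) ^ ?d"
    unfolding poly_altdef deg lessThan_Suc_atMost[symmetric] sum.lessThan_Suc lead by simp
  finally have eq: "\<omega> (Suc m) ^ ?d = - (u * of_nat p) - (\<Sum>i<?d. Polynomial.coeff h i * \<omega> (Suc m) ^ i)"
    by (simp add: algebra_simps)
  define c where "c = (\<lambda>i. (if i = 0 then - (u * of_nat p) else 0) - Polynomial.coeff h i)"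
  have "?d > 0"
    using p_gt_1 by simp
  then have "(\<Sum>i<?d. (if i = 0 then - (u * of_nat p) else 0) * \<omega> (Suc m) ^ i) = - (u * of_nat p)"
    using sum.delta[of "{..<?d}" 0 "\<lambda>i. - (u * of_nat p)"]
    by (simp add: if_distrib[of "\<lambda>x. x * _"] cong: if_cong)
  then have "\<omega> (Suc m) ^ ?d = (\<Sum>i<?d. c i * \<omega> (Suc m) ^ i)"
    by (simp only: eq c_def left_diff_distrib sum_subtractf)
  moreover have "c i \<in> Qp v" for i
    using K(1,3,6,7) assms(1) of_nat_Qp h_Qp by (simp add: c_def)
  ultimately show ?thesis
    by (auto simp: Qp_span_def)
qed

text \<open>The d-th power of the absolute value of \<omega>_n is 1/p with d the bound on the
  degree, so no smaller positive power lies in the value group of Q_p.\<close>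

lemma residue_field_coherent_root:
  assumes u: "u \<in> Qp v" "u ^ (p - 1) = 1"
    and \<omega>: "coherent_roots (\<lambda>x. x ^ p + u * of_nat p * x) \<omega>"
    and x: "x \<in> Qp_adjoin v (\<omega> n)" "v x \<le> 1"
  shows "v (x - x ^ p) < 1"
proof (cases n)
  case 0
  then have 0: "\<omega> n = 0"
    using \<omega> by (simp add: coherent_roots_def)
  \<comment> \<open>For \<open>n = 0\<close> nothing is adjoined; with \<open>d = 1\<close> the
    condition on absolute values is vacuous.\<close>
  have "\<omega> n ^ 1 \<in> Qp_span 1 (\<omega> n)"
    using is_subfieldD(1)[OF is_subfield_Qp] by (auto simp: Qp_span_def 0 intro!: exI[of _ "\<lambda>_. 0"])
  then have "x \<in> Qp_span 1 (\<omega> n)"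
    using Qp_adjoin_subset_span[of 1] x(1) by auto
  from this zero_less_one x(2) show ?thesis
    by (rule totally_ramified_residue) auto
next
  case (Suc m)
  define d where "d = p ^ m * (p - 1)"
  have d: "d > 0"
    using p_gt_1 by (simp add: d_def)
  have vd: "v (\<omega> n) ^ d = 1 / real p"
    using v_coherent_root[OF u(2) \<omega>, of m] by (simp add: d_def Suc)
  have "x \<in> Qp_span d (\<omega> n)"
    using Qp_adjoin_subset_span[of d "\<omega> n"] coherent_root_power_span[OF u(1) \<omega>, of m] d x(1)
    by (auto simp: d_def Suc)
  then show ?thesis
    using d x(2)
  proof (rule totally_ramified_residue)
    fix i k assume i: "0 < i" "i < d"
    show "v (\<omega> n) ^ i \<noteq> real p powi k"
    proof
      assume eq: "v (\<omega> n) ^ i = real p powi k"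
      \<comment> \<open>Taking d-th powers turns the supposed equality into
        \<open>- i = k * d\<close>, impossible for 0 < i < d.\<close>
      have "real p powi (- int i) = (v (\<omega> n) ^ d) ^ i"
        using p_gt_1 by (simp add: vd power_int_minus power_inverse divide_inverse)
      also have "\<dots> = (v (\<omega> n) ^ i) ^ d"
        by (simp add: mult.commute flip: power_mult)
      also have "\<dots> = real p powi (k * int d)"
        by (simp add: eq power_int_mult)
      finally have "- int i = k * int d"
        using p_gt_1 power_int_strict_increasing[of _ _ "real p"]
        by (metis less_irrefl linorder_neqE of_nat_1 of_nat_less_iff)
      then have "int d dvd int i"
        by (metis dvd_minus_iff dvd_triv_right)
      then show False
        using i by (auto dest: dvd_imp_le)
    qed
  qed
qed

end

section \<open>Change of basis over the Robba ring\<close>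

definition fps_laurent :: "'a::zero fps \<Rightarrow> int \<Rightarrow> 'a" where
  "fps_laurent F n = (if n \<ge> 0 then F $ nat n else 0)"

section \<open>Power series inside the Robba rings\<close>

lemma fps_laurent_add:
  fixes F G :: "'a::monoid_add fps"
  shows "fps_laurent (F + G) = (\<lambda>n. fps_laurent F n + fps_laurent G n)"
  by (auto simp: fps_laurent_def fun_eq_iff)

lemma X_deriv_fps_laurent: "X_deriv (fps_laurent F) = fps_laurent (fps_X * fps_deriv F)"
proof
  fix n
  show "X_deriv (fps_laurent F) n = fps_laurent (fps_X * fps_deriv F) n"
    by (cases "n > 0") (auto simp: X_deriv_def fps_laurent_def Suc_nat_eq_nat_zadd1)
qed

context padic_algebraic_closure
begin

text \<open>The partial sums are constant once the finite set contains \<open>A\<close>, and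
  \<open>v\<close> separates points, so the limit exists and is unique.\<close>

lemma v_infsum_eq_sum:
  assumes "finite A" "\<And>k. k \<notin> A \<Longrightarrow> c k = 0"
  shows "v_infsum v c = sum c A"
proof -
  let ?F = "finite_subsets_at_top (UNIV :: int set)"
  have "eventually (\<lambda>F. finite F \<and> A \<subseteq> F \<and> F \<subseteq> UNIV) ?F"
    using assms(1) by (auto simp: eventually_finite_subsets_at_top)
  then have "eventually (\<lambda>F. sum c F = sum c A) ?F"
  proof eventually_elim
    case (elim F)
    then show ?case
      using assms by (intro sum.mono_neutral_right) auto
  qed
  then have ev: "eventually (\<lambda>F. v (s - sum c F) = v (s - sum c A)) ?F" for s
    by eventually_elim simp
  have "((\<lambda>F. v (s - sum c F)) \<longlongrightarrow> 0) ?F \<longleftrightarrow> s = sum c A" for s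
  proof -
    have "((\<lambda>F. v (s - sum c F)) \<longlongrightarrow> 0) ?F \<longleftrightarrow> ((\<lambda>F. v (s - sum c A)) \<longlongrightarrow> 0) ?F"
      by (rule tendsto_cong[OF ev])
    also have "\<dots> \<longleftrightarrow> s = sum c A"
      by (simp add: tendsto_const_iff v_eq_0_iff)
    finally show ?thesis .
  qed
  then show ?thesis
    by (simp add: v_infsum_def)
qed

lemma v_infsum_fps_laurent:
  "(\<lambda>n. v_infsum v (\<lambda>k. fps_laurent F k * fps_laurent G (n - k))) = fps_laurent (F * G)"
proof
  fix n :: int
  have "v_infsum v (\<lambda>k. fps_laurent F k * fps_laurent G (n - k)) =
      (\<Sum>k\<in>{0..n}. fps_laurent F k * fps_laurent G (n - k))"
    by (rule v_infsum_eq_sum) (auto simp: fps_laurent_def)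
  also have "\<dots> = fps_laurent (F * G) n"
  proof (cases "n \<ge> 0")
    case True
    have "(\<Sum>k\<in>{0..n}. fps_laurent F k * fps_laurent G (n - k)) =
        (\<Sum>i\<in>{0..nat n}. F $ i * G $ (nat n - i))"
      using True
      by (intro sum.reindex_bij_witness[of _ int nat]) (auto simp: fps_laurent_def nat_diff_distrib)
    then show ?thesis
      using True by (simp add: fps_laurent_def fps_mult_nth)
  qed (simp add: fps_laurent_def)
  finally show "v_infsum v (\<lambda>k. fps_laurent F k * fps_laurent G (n - k)) = fps_laurent (F * G) n" .
qed

lemma laurent_ring_fps_simps:
  assumes "R \<in> {robba_ring v L, robba_ring_at_0 v L}"
  shows "fps_laurent F \<otimes>\<^bsub>R\<^esub> fps_laurent G = fps_laurent (F * G)"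
    and "fps_laurent F \<oplus>\<^bsub>R\<^esub> fps_laurent G = fps_laurent (F + G)"
    and "\<one>\<^bsub>R\<^esub> = fps_laurent 1"
  using assms
  by (auto simp: robba_ring_def robba_ring_at_0_def laurent_ring_def v_infsum_fps_laurent
      fps_laurent_add) (auto simp: fps_laurent_def fun_eq_iff)

text \<open>Bounded coefficients give convergence on the open unit disc, and the vanishing negative
  coefficients settle the other end; this serves both versions of the ring.\<close>

lemma fps_laurent_in_robba:
  assumes R: "R \<in> {robba_ring v L, robba_ring_at_0 v L}"
    and "0 \<in> L" "\<And>m. F $ m \<in> L" "\<And>m. v (F $ m) \<le> 1"
  shows "fps_laurent F \<in> carrier R"
proof -
  let ?a = "fps_laurent F"
  have L: "?a n \<in> L" for n
    using assms(2,3) by (simp add: fps_laurent_def)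
  have top: "((\<lambda>n. v (?a n) * \<rho> powi n) \<longlongrightarrow> 0) at_top" if "0 < \<rho>" "\<rho> < 1" for \<rho>
  proof (rule Lim_null_comparison)
    show "eventually (\<lambda>n. norm (v (?a n) * \<rho> powi n) \<le> \<rho> ^ nat n) at_top"
      using eventually_ge_at_top[of "0::int"]
    proof eventually_elim
      case (elim n)
      then show ?case
        using that assms(4)[of "nat n"] v_nonneg[of "F $ nat n"]
        by (auto simp: fps_laurent_def power_int_def abs_mult intro!: mult_left_le_one_le)
    qed
    show "((\<lambda>n. \<rho> ^ nat n) \<longlongrightarrow> 0) at_top"
      using that
      by (intro filterlim_compose[OF LIMSEQ_power_zero filterlim_nat_sequentially]) simp
  qed
  have bot: "((\<lambda>n. v (?a n) * \<rho> powi n) \<longlongrightarrow> 0) at_bot" for \<rho> :: real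
  proof (rule tendsto_eventually)
    show "eventually (\<lambda>n. v (?a n) * \<rho> powi n = 0) at_bot"
      using eventually_le_at_bot[of "- 1 :: int"] by eventually_elim (simp add: fps_laurent_def)
  qed
  have ex: "\<exists>\<alpha>. 0 < \<alpha> \<and> \<alpha> < 1 \<and> ((\<lambda>n. v (?a n) * \<alpha> powi n) \<longlongrightarrow> 0) at_bot"
    "\<exists>\<alpha>. 0 < \<alpha> \<and> \<alpha> < 1 \<and> ((\<lambda>n. v (?a n) * \<alpha> powi n) \<longlongrightarrow> 0) at_top"
    by (rule exI[of _ "1 / 2"], simp add: top bot)+
  consider "R = robba_ring v L" | "R = robba_ring_at_0 v L"
    using R by blast
  then show ?thesis
  proof cases
    case 1
    then show ?thesis
      using ex(1) by (simp add: robba_ring_def laurent_ring_def L top)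
  next
    case 2
    then show ?thesis
      using ex(2) by (simp add: robba_ring_at_0_def laurent_ring_def L bot)
  qed
qed

end

text \<open>If \<open>e\<close> is the given basis, the new one is \<open>a\<close> times
  \<open>e\<close>: the gauge equation computes \<open>D\<close> on it, and multiplication by the
  inverse \<open>b\<close> converts coordinates.\<close>

lemma defined_by_change_basis:
  fixes R :: "(int \<Rightarrow> 'k::field_char_0) ring" and M :: "(int \<Rightarrow> 'k, 'm) module"
  assumes "defined_by R g M D"
    and carrier: "a \<in> carrier R" "b \<in> carrier R" "X_deriv a \<in> carrier R" "g' \<in> carrier R"
    and inv: "a \<otimes>\<^bsub>R\<^esub> b = \<one>\<^bsub>R\<^esub>"
    and gauge: "a \<otimes>\<^bsub>R\<^esub> g \<oplus>\<^bsub>R\<^esub> X_deriv a = g' \<otimes>\<^bsub>R\<^esub> a"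
  shows "defined_by R g' M D"
proof -
  have g: "g \<in> carrier R" and DM: "differential_module R M D"
    using assms(1) by (auto simp: defined_by_def)
  obtain e where e: "e \<in> carrier M" "\<And>m. m \<in> carrier M \<Longrightarrow> \<exists>!c. c \<in> carrier R \<and> m = c \<odot>\<^bsub>M\<^esub> e"
    "D e = g \<odot>\<^bsub>M\<^esub> e"
    using assms(1) by (auto simp: defined_by_def)
  interpret module R M
    using DM by (simp add: differential_module_def)
  let ?e = "a \<odot>\<^bsub>M\<^esub> e"
  have "D ?e = a \<odot>\<^bsub>M\<^esub> (g \<odot>\<^bsub>M\<^esub> e) \<oplus>\<^bsub>M\<^esub> X_deriv a \<odot>\<^bsub>M\<^esub> e"
    using DM carrier(1) e(1,3) by (simp add: differential_module_def)
  also have "\<dots> = (a \<otimes>\<^bsub>R\<^esub> g \<oplus>\<^bsub>R\<^esub> X_deriv a) \<odot>\<^bsub>M\<^esub> e"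
    using carrier g e(1) by (simp add: smult_l_distr smult_assoc1)
  also have "\<dots> = g' \<odot>\<^bsub>M\<^esub> ?e"
    using carrier e(1) by (simp add: gauge smult_assoc1)
  finally have D: "D ?e = g' \<odot>\<^bsub>M\<^esub> ?e" .
  have basis: "\<exists>!c. c \<in> carrier R \<and> m = c \<odot>\<^bsub>M\<^esub> ?e" if m: "m \<in> carrier M" for m
  proof -
    obtain c where c: "c \<in> carrier R" "m = c \<odot>\<^bsub>M\<^esub> e"
      and uniq: "\<And>c'. c' \<in> carrier R \<Longrightarrow> m = c' \<odot>\<^bsub>M\<^esub> e \<Longrightarrow> c' = c"
      using e(2)[OF m] by blast
    have "c = (c \<otimes>\<^bsub>R\<^esub> b) \<otimes>\<^bsub>R\<^esub> a"
      using carrier c(1) inv by (metis R.m_assoc R.m_comm R.r_one)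
    then have "m = (c \<otimes>\<^bsub>R\<^esub> b) \<odot>\<^bsub>M\<^esub> ?e"
      using c carrier e(1) by (metis R.m_closed smult_assoc1)
    moreover have "c' = c \<otimes>\<^bsub>R\<^esub> b" if "c' \<in> carrier R" "m = c' \<odot>\<^bsub>M\<^esub> ?e" for c'
    proof -
      have "c' \<otimes>\<^bsub>R\<^esub> a = c"
        using that carrier e(1) by (intro uniq) (simp_all add: smult_assoc1)
      then show ?thesis
        using carrier that(1) inv by (metis R.m_assoc R.r_one)
    qed
    ultimately show ?thesis
      using c(1) carrier by blast
  qed
  show ?thesis
    unfolding defined_by_def
    using carrier(4) DM D basis smult_closed[OF carrier(1) e(1)] by blast
qed

lemma fps_power_nth_closed:
  assumes L: "is_subfield L" and "\<And>m. F $ m \<in> L"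
  shows "(F ^ k) $ m \<in> L"
proof (induction k arbitrary: m)
  case 0
  show ?case
    using is_subfieldD(1,2)[OF L] by simp
next
  case (Suc k)
  then show ?case
    unfolding power_Suc fps_mult_nth using assms(2) by (intro is_subfieldD(11,7)[OF L])
qed

lemma fps_exp_compose_nth_closed:
  assumes L: "is_subfield L" and "\<And>m. F $ m \<in> L"
  shows "fps_exp_compose F $ m \<in> L"
proof -
  have exp: "fps_exp (1 :: 'a) $ i = 1 / of_nat (fact i)" for i
    by simp
  show ?thesis
    unfolding fps_exp_compose_def fps_compose_nth exp
    by (intro is_subfieldD(11,7,8,2,10)[OF L] fps_power_nth_closed assms)
qed

lemma (in padic_algebraic_closure) frobenius_lift_id:
  assumes "\<And>x. x \<in> L \<Longrightarrow> v x \<le> 1 \<Longrightarrow> v (x - x ^ p) < 1"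
  shows "frobenius_lift p v L (\<lambda>x. x)"
  using assms
  by (auto simp: frobenius_lift_def ring_iso_def ring_hom_def bij_betw_def inj_on_def)

lemma differential_module_iso_refl: "differential_module_iso R M D M D (\<lambda>m. m)"
  by (auto simp: differential_module_iso_def bij_betw_def)

text \<open>For odd f this makes exp(-G) the exponential of another logarithm, at -\<omega>_n, so
  one integrality result covers both.\<close>

lemma lubin_tate_log_uminus:
  assumes "\<And>x. f (- x) = - f x"
  shows "lubin_tate_log p f (- t) = - lubin_tate_log p f t"
proof -
  have "(f ^^ i) (- t) = - (f ^^ i) t" for i
    by (induction i) (simp_all add: assms)
  then show ?thesis
    by (intro fps_ext) (simp add: lubin_tate_log_def sum_negf)
qed

theorem theorem5p15:
  fixes p n :: nat and v :: "'k::field_char_0 \<Rightarrow> real" and u :: 'k and \<omega> :: "nat \<Rightarrow> 'k"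
    and R :: "(int \<Rightarrow> 'k) ring" and M :: "(int \<Rightarrow> 'k, 'm) module" and D :: "'m \<Rightarrow> 'm"
  assumes "padic_algebraic_closure p v" and "odd p"
    and "u \<in> Qp v" and "u ^ (p - 1) = 1"
    and "coherent_roots (\<lambda>x. x ^ p + u * of_nat p * x) \<omega>"
    and "R \<in> {robba_ring v (Qp_adjoin v (\<omega> n)), robba_ring_at_0 v (Qp_adjoin v (\<omega> n))}"
    and "defined_by R (\<lambda>k. \<Sum>i<n. laurent_monom (\<omega> (n - i)) (p ^ i) k) M D"
  shows "has_frobenius_structure p v (Qp_adjoin v (\<omega> n)) R M D"
proof -
  interpret padic_algebraic_closure p v
    by fact
  note R = assms(6)
  define L where "L = Qp_adjoin v (\<omega> n)"
  define f where "f = (\<lambda>x. x ^ p + u * of_nat p * x)"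
  define G where "G = lubin_tate_log p f (\<omega> n)"
  \<comment> \<open>The exponential of \<open>W\<close> is the gauge factor between the module and
    its pullback.\<close>
  define W where "W = (G oo fps_X ^ p) - G"
  define g where "g = fps_X * fps_deriv G"
  define g' where "g' = of_nat p * (g oo fps_X ^ p)"
  have X: "(fps_X ^ p :: 'k fps) $ 0 = 0"
    using p_gt_1 by simp
  have u: "v u \<le> 1"
    using v_root_of_unity[OF assms(4)] p_gt_1 by simp
  have \<omega>_le_1: "v (\<omega> i) \<le> 1" for i
    by (rule v_coherent_root_le_1[OF assms(4,5)])
  have "field (ring_of_type_algebra :: 'k ring)"
    by (rule field_from_type_algebra)
  then have L: "is_subfield L"
    unfolding L_def Qp_adjoin_def
    by (intro subfield_imp_is_subfield field.generate_field_is_subfield) simp_all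
  note LD = is_subfieldD[OF L]
  have "Qp v \<subseteq> L" and \<omega>_L: "\<omega> n \<in> L"
    by (auto simp: L_def Qp_adjoin_def intro: generate_field.incl)
  have u_L: "u \<in> L"
    using assms(3) \<open>Qp v \<subseteq> L\<close> by blast
  have f_iter: "(f ^^ i) (\<omega> n) = \<omega> (n - i)" for i
  proof (induction i)
    case (Suc i)
    have "f (\<omega> (n - i)) = \<omega> (n - Suc i)"
    proof (cases "i < n")
      case True
      then have "n - i \<ge> 1" "n - i - 1 = n - Suc i"
        by auto
      then show ?thesis
        using assms(5) by (auto simp: coherent_roots_def f_def)
    next
      \<comment> \<open>Beyond \<open>n\<close> the truncated difference stays at 0, which agrees
        with f(0) = 0.\<close>
      case False
      then show ?thesis
        using assms(5) p_gt_1 by (simp add: coherent_roots_def f_def)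
    qed
    then show ?case
      using Suc by simp
  qed simp
  have iter_L: "(f ^^ i) (\<omega> n) \<in> L" for i
    by (induction i) (auto simp: f_def intro!: LD(5,7,9,10) u_L \<omega>_L)
  have G0: "G $ 0 = 0"
    using lubin_tate_log_nth_0 p_gt_1 by (simp add: G_def)
  have G_L: "G $ m \<in> L" for m
    unfolding G_def lubin_tate_log_def fps_nth_Abs_fps by (intro LD(11,8,10) iter_L)
  have g_nth: "g $ m = of_nat m * G $ m" for m
    by (cases m) (simp_all add: g_def)
  have g_power: "g $ (p ^ i) = \<omega> (n - i)" for i
    using lubin_tate_log_nth_power[OF p_gt_1, of f "\<omega> n" i] p_gt_1 by (simp add: g_nth G_def f_iter)
  have g_other: "g $ m = 0" if "\<And>i. m \<noteq> p ^ i" for m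
    using lubin_tate_log_nth_other[of m p f "\<omega> n"] that by (simp add: g_nth G_def)
  have g_le_1: "v (g $ m) \<le> 1" for m
    using \<omega>_le_1 g_power g_other by (cases "\<exists>i. m = p ^ i") auto
  have g'_nth: "g' $ m = of_nat p * (if p dvd m then g $ (m div p) else 0)" for m
    by (simp add: g'_def fps_nth_compose_X_power flip: fps_of_nat)
  have g_L: "g $ m \<in> L" for m
    unfolding g_nth by (intro LD(7,10) G_L)
  have g'_L: "g' $ m \<in> L" for m
    unfolding g'_nth using LD(1) by (auto intro!: LD(7,10) g_L)
  have g'_le_1: "v (g' $ m) \<le> 1" for m
    unfolding g'_nth using g_le_1 v_of_nat_le_1[of p] v_nonneg by (auto simp: v_mult intro!: mult_le_one)
  have g_eq: "(\<lambda>k. \<Sum>i<n. laurent_monom (\<omega> (n - i)) (p ^ i) k) = fps_laurent g"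
  proof
    fix k :: int
    consider "k < 0" | i where "k = int (p ^ i)" | "k \<ge> 0" "\<And>i. nat k \<noteq> p ^ i"
      by (metis int_nat_eq linorder_not_less)
    then show "(\<Sum>i<n. laurent_monom (\<omega> (n - i)) (p ^ i) k) = fps_laurent g k"
    proof cases
      case 1
      then have "k \<noteq> int (p ^ i)" for i
        by (metis of_nat_0_le_iff not_less)
      then show ?thesis
        using 1 by (simp add: laurent_monom_def fps_laurent_def)
    next
      case (2 i)
      have "(\<Sum>j<n. laurent_monom (\<omega> (n - j)) (p ^ j) k) = (\<Sum>j<n. if i = j then \<omega> (n - j) else 0)"
        using p_gt_1 by (intro sum.cong) (auto simp: laurent_monom_def 2 simp flip: of_nat_power)
      \<comment> \<open>For \<open>i\<close> at least \<open>n\<close> both sides vanish, because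
        \<omega>_0 = 0.\<close>
      also have "\<dots> = \<omega> (n - i)"
        using assms(5) by (simp add: coherent_roots_def)
      finally show ?thesis
        by (simp only: 2 fps_laurent_def nat_int g_power of_nat_0_le_iff if_True)
    next
      case 3
      then have "k \<noteq> int (p ^ i)" for i
        by (metis nat_int)
      then show ?thesis
        using 3 g_other[of "nat k"] by (simp add: laurent_monom_def fps_laurent_def)
    qed
  qed
  have \<phi>_eq: "(\<lambda>n. of_nat p * (if int p dvd n then fps_laurent g (n div int p) else 0)) = fps_laurent g'"
  proof
    fix k :: int
    show "of_nat p * (if int p dvd k then fps_laurent g (k div int p) else 0) = fps_laurent g' k"
    proof (cases "k \<ge> 0")
      case True
      then obtain m where "k = int m"
        using nonneg_int_cases by blast
      then show ?thesis
        by (simp add: fps_laurent_def g'_nth nat_div_distrib flip: zdiv_int)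
    next
      case False
      then have "k div int p < 0"
        using p_gt_1 pos_imp_zdiv_neg_iff[of "int p" k] by simp
      then show ?thesis
        using False by (simp add: fps_laurent_def)
    qed
  qed
  have exp_G: "v (fps_exp_compose G $ m) \<le> 1" for m
    unfolding G_def using v_exp_lubin_tate_log_le_1[OF assms(3) u f_def \<omega>_le_1] .
  \<comment> \<open>Here the oddness of \<open>p\<close> enters.\<close>
  have "f (- x) = - f x" for x
    using assms(2) by (simp add: f_def)
  then have exp_mG: "v (fps_exp_compose (- G) $ m) \<le> 1" for m
    using v_exp_lubin_tate_log_le_1[OF assms(3) u f_def, of "- \<omega> n" m] \<omega>_le_1
    by (simp add: G_def lubin_tate_log_uminus)
  have W0: "W $ 0 = 0"
    using G0 p_gt_1 by (simp add: W_def)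
  \<comment> \<open>Series with integral coefficients are closed under products and under
    substitution of X^p.\<close>
  have bound: "v ((A * (B oo fps_X ^ p)) $ m) \<le> 1"
    if "\<And>m. v (A $ m) \<le> 1" "\<And>m. v (B $ m) \<le> 1" for A B m
    unfolding fps_mult_nth
    by (rule v_sum_le) (use that v_nonneg in \<open>auto simp: v_mult fps_nth_compose_X_power intro!: mult_le_one\<close>)
  have "fps_exp_compose W = fps_exp_compose (- G) * (fps_exp_compose G oo fps_X ^ p)"
  proof -
    have "W = - G + (G oo fps_X ^ p)"
      by (simp add: W_def)
    then show ?thesis
      using fps_exp_compose_add[of "- G" "G oo fps_X ^ p"] G0
      by (simp only: fps_exp_compose_compose[OF G0 X]) simp
  qed
  then have exp_W: "v (fps_exp_compose W $ m) \<le> 1" for m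
    using bound exp_G exp_mG by simp
  have "fps_exp_compose (- W) = fps_exp_compose G * (fps_exp_compose (- G) oo fps_X ^ p)"
  proof -
    have "- W = G + (- G oo fps_X ^ p)" "(- G) $ 0 = 0"
      using G0 by (simp_all add: W_def fps_compose_uminus)
    then show ?thesis
      using fps_exp_compose_add[of G "- G oo fps_X ^ p"] G0
      by (simp only: fps_exp_compose_compose[OF _ X]) simp
  qed
  then have exp_mW: "v (fps_exp_compose (- W) $ m) \<le> 1" for m
    using bound exp_G exp_mG by simp
  have W_L: "W $ m \<in> L" for m
    using LD(1,3,6) G_L by (simp add: W_def fps_nth_compose_X_power)
  then have mW_L: "(- W) $ m \<in> L" for m
    using LD(3) by simp
  \<comment> \<open>Applying X d/dX to G(X^p) produces a factor \<open>p\<close>, the same factor as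
    in the pullback.\<close>
  have XW: "fps_X * fps_deriv W = g' - g"
  proof (rule fps_ext)
    fix m
    have "(fps_X * fps_deriv W) $ m = of_nat m * W $ m"
      by (cases m) simp_all
    also have "\<dots> = (g' - g) $ m"
    proof (cases "p dvd m")
      case True
      then obtain k where k: "m = p * k"
        by blast
      then have "m div p = k"
        using p_gt_1 by simp
      then show ?thesis
        by (simp add: W_def fps_nth_compose_X_power g'_nth g_nth right_diff_distrib True)
          (simp add: k)
    qed (simp add: W_def fps_nth_compose_X_power g'_nth g_nth)
    finally show "(fps_X * fps_deriv W) $ m = (g' - g) $ m" .
  qed
  have XdW: "fps_X * fps_deriv (fps_exp_compose W) = (g' - g) * fps_exp_compose W"
    unfolding XW[symmetric] fps_deriv_exp_compose[OF W0] by (simp only: mult.assoc)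
  have in_R: "fps_laurent F \<in> carrier R" if "\<And>m. F $ m \<in> L" "\<And>m. v (F $ m) \<le> 1" for F
    using fps_laurent_in_robba[OF R, folded L_def] LD(1) that by blast
  have g: "defined_by R (fps_laurent g) M D"
    using assms(7) by (simp only: g_eq)
  have g': "defined_by R (fps_laurent g') M D"
    using g
  proof (rule defined_by_change_basis)
    show "fps_laurent (fps_exp_compose W) \<in> carrier R" "fps_laurent (fps_exp_compose (- W)) \<in> carrier R"
      by (intro in_R fps_exp_compose_nth_closed[OF L] W_L mW_L exp_W exp_mW)+
    show "fps_laurent g' \<in> carrier R"
      by (intro in_R g'_L g'_le_1)
    show "X_deriv (fps_laurent (fps_exp_compose W)) \<in> carrier R"
      unfolding X_deriv_fps_laurent
    proof (rule in_R)
      fix m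
      have nth: "(fps_X * fps_deriv (fps_exp_compose W)) $ m = of_nat m * fps_exp_compose W $ m"
        by (cases m) simp_all
      show "(fps_X * fps_deriv (fps_exp_compose W)) $ m \<in> L"
        unfolding nth by (intro LD(7,10) fps_exp_compose_nth_closed[OF L] W_L)
      show "v ((fps_X * fps_deriv (fps_exp_compose W)) $ m) \<le> 1"
        unfolding nth v_mult by (intro mult_le_one v_of_nat_le_1 exp_W v_nonneg)
    qed
    have "fps_exp_compose W * fps_exp_compose (- W) = 1"
      using fps_exp_compose_add[of W "- W"] W0 by simp
    then show "fps_laurent (fps_exp_compose W) \<otimes>\<^bsub>R\<^esub> fps_laurent (fps_exp_compose (- W)) = \<one>\<^bsub>R\<^esub>"
      by (simp only: laurent_ring_fps_simps[OF R])
    show "fps_laurent (fps_exp_compose W) \<otimes>\<^bsub>R\<^esub> fps_laurent g \<oplus>\<^bsub>R\<^esub>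
        X_deriv (fps_laurent (fps_exp_compose W)) = fps_laurent g' \<otimes>\<^bsub>R\<^esub> fps_laurent (fps_exp_compose W)"
      unfolding X_deriv_fps_laurent laurent_ring_fps_simps[OF R] XdW
      by (simp add: algebra_simps)
  qed
  \<comment> \<open>The absolute Frobenius attached to the identity of the coefficient field, so
    only X is replaced by X^p.\<close>
  define \<phi> :: "(int \<Rightarrow> 'k) \<Rightarrow> int \<Rightarrow> 'k" where
    "\<phi> = (\<lambda>a n. if int p dvd n then a (n div int p) else 0)"
  have \<phi>_g: "(\<lambda>n. of_nat p * \<phi> (fps_laurent g) n) = fps_laurent g'"
    unfolding \<phi>_def by (rule \<phi>_eq)
  \<comment> \<open>\<open>M\<close> has one basis with \<open>D\<close>-coefficient
    \<open>g\<close> and another with \<open>g'\<close>, so it represents its own pullback and the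
    identity is the required isomorphism.\<close>
  have "frobenius_pullback p R \<phi> M D M D"
    unfolding frobenius_pullback_def by (rule exI[of _ "fps_laurent g"]) (simp only: \<phi>_g g g')
  moreover have "frobenius_lift p v L (\<lambda>x. x)"
    using residue_field_coherent_root[OF assms(3-5)] unfolding L_def by (intro frobenius_lift_id) blast
  then have "absolute_frobenius p v L \<phi>"
    unfolding absolute_frobenius_def \<phi>_def by (intro exI[of _ "\<lambda>x. x"]) simp
  ultimately show ?thesis
    unfolding has_frobenius_structure_def L_def[symmetric] using differential_module_iso_refl by metis
qed

end
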